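(* Let $F[y(t),u(t)]=0$, with $F$ a $\delta\epsilon$-polynomial without constant term, be a nonlinear discrete input-output system with cross-products (the nominal nonlinear system). Let $A$ be the linear output part of $F$ and $-B$ its linear input part (that is, $F_{\delta,l}=A$, $F_{\epsilon,l}=-B$), and let $A_dy^*(t)=0$, $A_d$ a linear $\delta$-polynomial, be a desired linear system. Let $\mathbf F_1,\mathbf F_2,\mathbf F_3$ be the outputs of the MM-Algorithm applied to $F$, and suppose that at least one of them is nonempty. Then: (a) If $A_d$ belongs to some of the sets $\mathbf F_i$, $i=1,2,3$, then the feedback law $u(t)=Sy(t)$ with $$S=\begin{cases}Q\ast A_d, & \text{if }A_d\in\mathbf F_1,\\ Q, & \text{if }A_d\in\mathbf F_2,\\ Z_0+Q\ast A_d, & \text{if }A_d\in\mathbf F_3,\end{cases}$$ where $(R_0,Z_0)$ is a solution of the Diophantine equation $R\ast A_d+Z\ast B=A$ in linear $\delta$-polynomials $R,Z$ and $Q$ is an arbitrary linear $\delta$-polynomial, gives a closed-loop system $F[y(t),Sy(t)]=0$ which produces an output $y(t)$ equal to $y^*(t)$ whenever the nominal nonlinear system and the desired linear system operate under identical initial conditions. (b) If $A_d$ does not belong to any of the sets $\mathbf F_i$, $i=1,2,3$, but there are subsets $\tilde{\mathbf F}_i\subseteq\mathbf F_i$, $i=1,2,3$, not all of them empty, such that $\gcd(A_d,\Phi)=\tilde\Phi\neq\delta_0$ for $\Phi\in\tilde{\mathbf F}_i$, $i=1,2,3$, then the feedback law $u(t)=Sy(t)$ with $$S=\begin{cases}Q\ast\tilde\Phi,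 & \text{if }\Phi\in\tilde{\mathbf F}_1,\\ Q, & \text{if }\Phi\in\tilde{\mathbf F}_2,\\ Z_0+Q\ast\tilde\Phi, & \text{if }\Phi\in\tilde{\mathbf F}_3,\end{cases}$$ where $(R_0,Z_0)$ is a solution of the Diophantine equation $R\ast\tilde\Phi+Z\ast B=A$ and $Q$ is an arbitrary linear $\delta$-polynomial, gives a closed-loop system which produces an output $y(t)$ equal to $y^*(t)$ whenever the nominal nonlinear system and the desired linear system operate under identical initial conditions $\mathbf y_0$ which satisfy the relation $\tilde\Phi\,\mathbf y_0=0$.
   Context: **$\delta\epsilon$-polynomials.** Signals are causal real sequences $y:\mathbb Z\to\mathbb R$, $y(t)=0$ for $t<0$. A multi-index is a finite nondecreasing tuple of nonnegative integers (the empty one is denoted $e$). For $\mathbf i=(i_1,\dots,i_n)$, $\mathbf j=(j_1,\dots,j_m)$ the $\delta\epsilon$-operator $\delta_{\mathbf i}\epsilon_{\mathbf j}=\delta_{i_1}\cdots\delta_{i_n}\epsilon_{j_1}\cdots\epsilon_{j_m}$ acts by $\delta_{\mathbf i}\epsilon_{\mathbf j}[y(t),u(t)]=y(t-i_1)\cdots y(t-i_n)\,u(t-j_1)\cdots u(t-j_m)$; $\delta_e,\epsilon_e$ stand for the empty product $1$. So $\delta\epsilon$-operators are monomials in commuting variables $\delta_0,\delta_1,\dots,\epsilon_0,\epsilon_1,\dots$, and a $\delta\epsilon$-polynomial is a finite linear combination of them (a polynomial in these variables), acting linearly in its monomials. The dot-product $\cdot$ is ordinary polynomial multiplication. The pure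 $\delta$-part $F_\delta$ (resp. pure $\epsilon$-part $F_\epsilon$) of $F$ collects the monomials containing only $\delta$'s (resp. only $\epsilon$'s); $F_{\delta\epsilon}=F-F_\delta-F_\epsilon$; $F_{\delta,l},F_{\epsilon,l}$ are the homogeneous degree-one parts of $F_\delta,F_\epsilon$. A linear $\delta$-polynomial is $\sum_k a_k\delta_k$ (finite sum, $k\ge 0$), a linear $\epsilon$-polynomial is $\sum_k b_k\epsilon_k$. **Star-product** (composition/substitution). For linear $\delta$-polynomials, $(\sum_k a_k\delta_k)\ast(\sum_l b_l\delta_l)=\sum_{k,l}a_kb_l\delta_{k+l}$; thus linear $\delta$-polynomials with $+,\ast$ form a ring isomorphic to $\mathbb R[x]$ ($\delta_k\leftrightarrow x^k$), with unit $\delta_0$; factor, common factor and $\gcd$ are understood in this ring, up to nonzero real scalars. When linear $\epsilon$-polynomials are compared with or multiplied with linear $\delta$-polynomials, $\epsilon_k$ is identified with $\delta_k$. For $L=\sum_k a_k\delta_k$, $M=\sum_k b_k\epsilon_k$ and a monomial, $\delta_{\mathbf i}\epsilon_{\mathbf j}\ast[L,M]=\prod_{p=1}^n(\sum_k a_k\delta_{k+i_p})\cdot\prod_{q=1}^m(\sum_k b_k\epsilon_{k+j_q})$; if $\mathbf j=e$ (resp. $\mathbf i=e$) the second (resp. first) slot is irrelevant and is written $\epsilon_e$ (resp. $\delta_e$). **Order and zero terms.** $\mathbf i\prec\mathbf i'$ if $\mathbf i$ has smaller length, or the lengths agree and the right-most nonzero entry of $\mathbf i'-\mathbf i$ is positive;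 $\delta_{\mathbf i}\epsilon_{\mathbf j}\prec\delta_{\mathbf i'}\epsilon_{\mathbf j'}$ if $\mathbf i\prec\mathbf i'$, or $\mathbf i=\mathbf i'$ and $\mathbf j\prec\mathbf j'$. A zero term is a monomial with $i_1=0$ (pure $\delta$ monomial), $j_1=0$ (pure $\epsilon$ monomial), or $i_1=j_1=0$ (mixed monomial). **FLF-Algorithm** (Formal Linear Factors). Input: a $\delta\epsilon$-polynomial $A$ without constant term. Coefficients arising are real polynomials in new undetermined parameters $w_{\lambda,u,h,k}$, $s_{\lambda,\omega,h,k}$. - Step 0. $h=0$; $\mathcal L,\mathcal M,\mathcal C,\mathcal O$ empty. - Step 1. Decompose the current $A=A_\delta+A_\epsilon+A_{\delta\epsilon}$. - Step 2. Set $u=1,\omega=0$. Repeat: call REMAINDER$(A_\delta;u,0,h)$, obtaining $R$; find the maximal $\theta\ge0$ with $R=\delta_0^{\theta}\cdot\tilde R$, $\tilde R$ without constant term; set $A_\delta=\tilde R$, $u=u+1$; until $A_\delta=0$ or $A_\delta$ is a polynomial in $\delta_0$ only. - Step 3. $R_{\delta,h}:=$ the last $A_\delta$. - Steps 4, 5. The same with $A_\epsilon$, $\epsilon_0$, exponents $\rho$, and indices $u=0$, $\omega=1,2,\dots$ (calls REMAINDER$(A_\epsilon;0,\omega,h)$); $R_{\epsilon,h}:=$ the last $A_\epsilon$. - Step 6. If $A_{\delta\epsilon}=0$ or $A_{\delta\epsilon}$ is a polynomial in $\delta_0,\epsilon_0$ only, set $R_{\delta\epsilon}=A_{\delta\epsilon}$,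 $h^*=h$ and stop. - Steps 7, 8, 9. Otherwise call REMAINDER$(A_{\delta\epsilon};0,0,h)$, obtaining $R$; find the maximal $\kappa,\sigma\ge0$ with $R=\delta_0^\kappa\epsilon_0^\sigma\cdot\tilde R$, $\tilde R$ without constant term; set $A=\tilde R$, $h=h+1$ and go to Step 1. REMAINDER$(A;u,\omega,h)$: split $A=R_l+R_{nl}$ into linear and nonlinear parts. If $R_l\ne0$: when $u\ge1$ put $L_{0,u,h}=R_l$ into $\mathcal L$; when $\omega\ge1$ put $M_{0,\omega,h}=R_l$ into $\mathcal M$; the companion coefficient is $1$. Set $R_0=R_{nl}$. For $\lambda=1,2,\dots$, as long as $R_{\lambda-1}$ contains a term which is not a zero term: let $c_{\lambda,u,\omega,h}\,\delta_{i_1}\cdots\delta_{i_n}\epsilon_{j_1}\cdots\epsilon_{j_m}$ be its maximum term that is not a zero term; if $n\ge1$ put $L_{\lambda,u,h}=w_{\lambda,u,h,0}\delta_0+\dots+w_{\lambda,u,h,i_1-1}\delta_{i_1-1}+\delta_{i_1}$ into $\mathcal L$ (else the slot is $\delta_e$); if $m\ge1$ put $M_{\lambda,\omega,h}=s_{\lambda,\omega,h,0}\epsilon_0+\dots+s_{\lambda,\omega,h,j_1-1}\epsilon_{j_1-1}+\epsilon_{j_1}$ into $\mathcal M$ (else the slot is $\epsilon_e$); set $R_\lambda=R_{\lambda-1}-c_{\lambda,u,\omega,h}\,\delta_0\delta_{i_2-i_1}\cdots\delta_{i_n-i_1}\epsilon_0\epsilon_{j_2-j_1}\cdots\epsilon_{j_m-j_1}\ast[L_{\lambda,u,h},M_{\lambda,\omega,h}]$;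 record $c_{\lambda,u,\omega,h}$ in $\mathcal C$ and the operator in $\mathcal O$. Return the last $R_\lambda$. The companion coefficient $ccoef$ of $L_{\lambda,u,h}$ or of $M_{\lambda,\omega,h}$ is $c_{\lambda,u,\omega,h}$ ($1$ if $\lambda=0$). **Derived sets** (algorithm applied to $F$). $\mathcal L^*=\mathcal L\setminus\{F_{\delta,l}\}$, $\mathcal M^*=\mathcal M\setminus\{F_{\epsilon,l}\}$, $\mathcal L_\delta=\{L_{\lambda,u,0}\in\mathcal L: u\ge1\}$ (linear factors of the $\delta$-part, including $F_{\delta,l}$), $\overline{\mathcal L}=\{L_{\lambda,u,h}\in\mathcal L:u\neq0\}$, $\overline{\mathcal M}=\{M_{\lambda,\omega,h}\in\mathcal M:\omega\ne0\}$, $\overline{\mathcal L}^*=\overline{\mathcal L}\setminus\{F_{\delta,l}\}$, $\overline{\mathcal M}^*=\overline{\mathcal M}\setminus\{F_{\epsilon,l}\}$. A rule $\mathbf q$ is an assignment of real values to all the parameters $w,s$; $|_{\mathbf q}$ denotes evaluation under it. **GCD-Values-Algorithm.** For a set $\mathcal F$ of formal linear polynomials, $GCDV(\mathcal F)$ is the set of all rules $\mathbf q$ for which there is a nonempty $\mathcal A\subseteq\mathcal F$ such that $ccoef(J)|_{\mathbf q}\neq0$ for $J\in\mathcal A$, $ccoef(\Psi)|_{\mathbf q}=0$ for $\Psi\in\mathcal F\setminus\mathcal A$, and $\gcd\{J|_{\mathbf q}:J\in\mathcal A\}\neq\delta_0$. A "common factor of $\mathcal F|_{\mathbf q}$" means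 a common factor of the $J|_{\mathbf q}$, $J\in\mathcal F$, with $ccoef(J)|_{\mathbf q}\neq0$. **MM-Algorithm.** Let $LV=GCDV(\mathcal L_\delta)$, $GV=GCDV(\mathcal L\cup\overline{\mathcal M})\cup GCDV(\overline{\mathcal L}\cup\mathcal M)$, $MV=GCDV(\mathcal L^*\cup\overline{\mathcal M}^* )\cup GCDV(\overline{\mathcal L}^*\cup\mathcal M^* )$, $DR=\{\mathbf q:R_{\delta,0}|_{\mathbf q}=0\}$, $RV=\{\mathbf q: R_{\delta,h}|_{\mathbf q}=R_{\epsilon,h}|_{\mathbf q}=0\ (0\le h\le h^* ),\ R_{\delta\epsilon}|_{\mathbf q}=0\}$. The outputs are (empty if no such rule exists): - $\mathbf F_1$: the linear polynomials $\Phi$ that are a common factor of $\mathcal L_\delta|_{\mathbf q}$ for some $\mathbf q\in LV\cap DR$; - $\mathbf F_2$: those that, for some $\mathbf q\in RV\cap GV$, are a common factor of $(\mathcal L\cup\overline{\mathcal M})|_{\mathbf q}$ or of $(\overline{\mathcal L}\cup\mathcal M)|_{\mathbf q}$; - $\mathbf F_3$: those that, for some $\mathbf q\in RV\cap MV$, are a common factor of $(\mathcal L^*\cup\overline{\mathcal M}^* )|_{\mathbf q}$ or of $(\overline{\mathcal L}^*\cup\mathcal M^* )|_{\mathbf q}$. **Systems and initial conditions.** It is assumed throughout that the minimal delay occurring in $F$ is $0$ and that $y(t)$ occurs in the linear part $F_{\delta,l}$ (and is the lowest-delay output term), so that the equation can be solved uniquely for $y(t)$. A system (with or without input) whose maximal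 output delay is $k$ is assigned initial conditions $\mathbf y_0=(y_0,\dots,y_{k-1})$, $y(0)=y_0,\dots,y(k-1)=y_{k-1}$, and, for a given input, the equation determines $y(t)$ for $t\ge k$. Two systems with outputs $y$ (initial conditions $(y_0,\dots,y_{k-1})$) and $\psi$ (initial conditions $(\psi_0,\dots,\psi_{\lambda-1})$), $k>\lambda$, operate under identical initial conditions if $\psi_i=y_i$ for $i<\lambda$ and $y_i=\psi(i)$ for $\lambda\le i\le k-1$. For a linear $\delta$-polynomial $K=\sum_{i=0}^{k-1}\tau_i\delta_i$, the relation $K\mathbf y_0=0$ means $\sum_{i=0}^{k-1}\tau_iy_{k-1-i}=0$.
   Formalization: In (b) the single relation Φ̃y_0=0 is required for y_0 and its n−1 next shorter initial segments, n=deg A_d−deg Φ̃ (one relation is not enough if n≥2); the number k of initial conditions is the closed loop's maximal output delay, and uniqueness of y assumes the loop is uniquely solvable for y(t). *)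

theory Defs
  imports
    "HOL-Library.Poly_Mapping"
    "HOL-Library.Multiset"
    "HOL-Library.Product_Plus"
    "HOL-Computational_Algebra.Polynomial_Factorial"
    "HOL-Computational_Algebra.Field_as_Ring"
begin

section \<open>Delta-epsilon-polynomials\<close>

text \<open>
  A multi-index (a finite nondecreasing tuple) is a finite multiset of naturals; the tuple itself is
  \<^term>\<open>sorted_list_of_multiset\<close> of it. The monomial with index pair \<open>(i, j)\<close> is
  \<open>\<delta>\<^sub>i \<epsilon>\<^sub>j\<close>, and multiplication in \<open>'c depoly\<close> is the dot-product.

  Linear polynomials, both in the \<open>\<delta>\<^sub>k\<close> and in the \<open>\<epsilon>\<^sub>k\<close>, are univariate polynomials: the
  variable with delay \<open>k\<close> is \<open>x ^ k\<close>, the star-product of linear polynomials is \<open>*\<close> on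
  \<open>'c poly\<close>, and the unit \<open>\<delta>\<^sub>0\<close> is \<open>1\<close>.
\<close>

type_synonym mono = "nat multiset \<times> nat multiset"
type_synonym 'c depoly = "mono \<Rightarrow>\<^sub>0 'c"

definition delta :: "nat \<Rightarrow> 'c::comm_ring_1 depoly" where
  "delta k = Poly_Mapping.single ({#k#}, {#}) 1"

definition eps :: "nat \<Rightarrow> 'c::comm_ring_1 depoly" where
  "eps k = Poly_Mapping.single ({#}, {#k#}) 1"

definition scale :: "'c \<Rightarrow> 'c::comm_ring_1 depoly \<Rightarrow> 'c depoly" where
  "scale c F = Poly_Mapping.single ({#}, {#}) c * F"

definition delta_linear :: "'c::comm_ring_1 poly \<Rightarrow> 'c depoly" where
  "delta_linear L = (\<Sum>k\<le>degree L. scale (coeff L k) (delta k))"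

definition eps_linear :: "'c::comm_ring_1 poly \<Rightarrow> 'c depoly" where
  "eps_linear M = (\<Sum>k\<le>degree M. scale (coeff M k) (eps k))"

text \<open>\<open>\<delta>\<^sub>i \<epsilon>\<^sub>j * [L, M]\<close>; the factor belonging to the entry \<open>p\<close> of \<open>i\<close> is
  \<open>\<Sum>k. a\<^sub>k \<delta>\<^bsub>k+p\<^esub>\<close>, i.e. \<open>x ^ p * L\<close>.\<close>

definition star :: "mono \<Rightarrow> 'c::comm_ring_1 poly \<Rightarrow> 'c poly \<Rightarrow> 'c depoly" where
  "star m L M = (\<Prod>p\<in>#fst m. delta_linear (monom 1 p * L)) * (\<Prod>p\<in>#snd m. eps_linear (monom 1 p * M))"

definition restrict_monos :: "(mono \<Rightarrow> bool) \<Rightarrow> 'c::comm_ring_1 depoly \<Rightarrow> 'c depoly" where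
  "restrict_monos P F =
     (\<Sum>m\<in>{m \<in> Poly_Mapping.keys F. P m}. Poly_Mapping.single m (Poly_Mapping.lookup F m))"

definition delta_part :: "'c::comm_ring_1 depoly \<Rightarrow> 'c depoly" where
  "delta_part = restrict_monos (\<lambda>m. fst m \<noteq> {#} \<and> snd m = {#})"

definition eps_part :: "'c::comm_ring_1 depoly \<Rightarrow> 'c depoly" where
  "eps_part = restrict_monos (\<lambda>m. fst m = {#} \<and> snd m \<noteq> {#})"

definition mixed_part :: "'c::comm_ring_1 depoly \<Rightarrow> 'c depoly" where
  "mixed_part F = F - delta_part F - eps_part F"

definition linear_part :: "'c::comm_ring_1 depoly \<Rightarrow> 'c depoly" where
  "linear_part = restrict_monos (\<lambda>m. size (fst m) + size (snd m) = 1)"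

text \<open>\<open>F\<^bsub>\<delta>,l\<^esub>\<close> and \<open>F\<^bsub>\<epsilon>,l\<^esub>\<close>, read as univariate polynomials.\<close>

definition delta_lin_part :: "'c::comm_ring_1 depoly \<Rightarrow> 'c poly" where
  "delta_lin_part F = (\<Sum>k\<in>{k. ({#k#}, {#}) \<in> Poly_Mapping.keys F}.
     monom (Poly_Mapping.lookup F ({#k#}, {#})) k)"

definition eps_lin_part :: "'c::comm_ring_1 depoly \<Rightarrow> 'c poly" where
  "eps_lin_part F = (\<Sum>k\<in>{k. ({#}, {#k#}) \<in> Poly_Mapping.keys F}.
     monom (Poly_Mapping.lookup F ({#}, {#k#})) k)"

definition no_constant :: "'c::comm_ring_1 depoly \<Rightarrow> bool" where
  "no_constant F \<longleftrightarrow> Poly_Mapping.lookup F ({#}, {#}) = 0"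

text \<open>A polynomial in \<open>\<delta>\<^sub>0, \<epsilon>\<^sub>0\<close> only (hence in \<open>\<delta>\<^sub>0\<close> only, if it is a pure \<open>\<delta>\<close>-polynomial).
  The zero polynomial is included.\<close>

definition undelayed :: "'c::comm_ring_1 depoly \<Rightarrow> bool" where
  "undelayed F \<longleftrightarrow> (\<forall>m\<in>Poly_Mapping.keys F. set_mset (fst m) \<subseteq> {0} \<and> set_mset (snd m) \<subseteq> {0})"

definition midx_less :: "nat multiset \<Rightarrow> nat multiset \<Rightarrow> bool" where
  "midx_less i i' \<longleftrightarrow> size i < size i' \<or> (size i = size i' \<and>
     (let xs = sorted_list_of_multiset i; ys = sorted_list_of_multiset i' in
        \<exists>p<length xs. xs ! p < ys ! p \<and> (\<forall>r. p < r \<and> r < length xs \<longrightarrow> xs ! r = ys ! r)))"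

definition mono_less :: "mono \<Rightarrow> mono \<Rightarrow> bool" where
  "mono_less m m' \<longleftrightarrow> midx_less (fst m) (fst m') \<or> (fst m = fst m' \<and> midx_less (snd m) (snd m'))"

text \<open>The tuples are nondecreasing, so \<open>i\<^sub>1 = 0\<close> means that \<open>0\<close> occurs in the multiset.\<close>

definition zero_term :: "mono \<Rightarrow> bool" where
  "zero_term m \<longleftrightarrow> (if snd m = {#} then 0 \<in># fst m
                   else if fst m = {#} then 0 \<in># snd m
                   else 0 \<in># fst m \<and> 0 \<in># snd m)"

section \<open>Formal coefficients\<close>

text \<open>\<open>W_par \<lambda> u h k\<close> and \<open>S_par \<lambda> \<omega> h k\<close> are the undetermined parameters
  \<open>w\<^bsub>\<lambda>,u,h,k\<^esub>\<close> and \<open>s\<^bsub>\<lambda>,\<omega>,h,k\<^esub>\<close>; a formal coefficient is a real polynomial in them.\<close>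

datatype param = W_par nat nat nat nat | S_par nat nat nat nat

type_synonym fcoeff = "param multiset \<Rightarrow>\<^sub>0 real"
type_synonym rule = "param \<Rightarrow> real"

definition par :: "param \<Rightarrow> fcoeff" where
  "par v = Poly_Mapping.single {#v#} 1"

definition const_coeff :: "real \<Rightarrow> fcoeff" where
  "const_coeff c = Poly_Mapping.single {#} c"

definition eval_coeff :: "rule \<Rightarrow> fcoeff \<Rightarrow> real" where
  "eval_coeff q c = (\<Sum>m\<in>Poly_Mapping.keys c. Poly_Mapping.lookup c m * (\<Prod>v\<in>#m. q v))"

definition eval_linear :: "rule \<Rightarrow> fcoeff poly \<Rightarrow> real poly" where
  "eval_linear q L = map_poly (eval_coeff q) L"

definition eval_depoly :: "rule \<Rightarrow> fcoeff depoly \<Rightarrow> real depoly" where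
  "eval_depoly q R = Poly_Mapping.map (eval_coeff q) R"

definition formal :: "real depoly \<Rightarrow> fcoeff depoly" where
  "formal F = Poly_Mapping.map const_coeff F"

section \<open>The FLF-Algorithm\<close>

text \<open>An entry of \<open>\<L>\<close> or \<open>\<M>\<close>, together with its indices and its companion coefficient. The
  field \<open>slot\<close> is \<open>u\<close> for entries of \<open>\<L>\<close> and \<open>\<omega>\<close> for entries of \<open>\<M>\<close>. Entries are
  distinguished by their indices, even if they happen to be equal as polynomials.\<close>

record factor =
  lev :: nat
  slot :: nat
  stage :: nat
  fpoly :: "fcoeff poly"
  ccoef :: fcoeff

definition max_nonzero_term :: "fcoeff depoly \<Rightarrow> mono \<Rightarrow> bool" where
  "max_nonzero_term R m \<longleftrightarrow> m \<in> Poly_Mapping.keys R \<and> \<not> zero_term m \<and>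
     (\<forall>m'\<in>Poly_Mapping.keys R. \<not> zero_term m' \<longrightarrow> m' = m \<or> mono_less m' m)"

definition generic_L :: "nat \<Rightarrow> nat \<Rightarrow> nat \<Rightarrow> nat \<Rightarrow> fcoeff poly" where
  "generic_L lam u h i1 = (\<Sum>k<i1. monom (par (W_par lam u h k)) k) + monom 1 i1"

definition generic_M :: "nat \<Rightarrow> nat \<Rightarrow> nat \<Rightarrow> nat \<Rightarrow> fcoeff poly" where
  "generic_M lam om h j1 = (\<Sum>k<j1. monom (par (S_par lam om h k)) k) + monom 1 j1"

text \<open>The algorithm is given as relations between inputs and results, because the maximal exponents
  \<open>\<kappa>, \<sigma>\<close> extracted in one of its steps need not be unique. The arguments of the relations are the
  current indices, the input polynomial, the entries added to \<open>\<L>\<close> and to \<open>\<M>\<close>, and the returned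
  remainder(s).\<close>

inductive rem_loop ::
  "nat \<Rightarrow> nat \<Rightarrow> nat \<Rightarrow> nat \<Rightarrow> fcoeff depoly \<Rightarrow> factor set \<Rightarrow> factor set \<Rightarrow> fcoeff depoly \<Rightarrow> bool"
  for u om h :: nat where
  rem_stop: "\<forall>m\<in>Poly_Mapping.keys R. zero_term m \<Longrightarrow> rem_loop u om h lam R {} {} R"
| rem_step:
  "\<lbrakk> max_nonzero_term R (i, j);
     c = Poly_Mapping.lookup R (i, j);
     i1 = (if i = {#} then 0 else Min_mset i);
     j1 = (if j = {#} then 0 else Min_mset j);
     L = generic_L lam u h i1;
     M = generic_M lam om h j1;
     R' = R - scale c (star (image_mset (\<lambda>p. p - i1) i, image_mset (\<lambda>p. p - j1) j) L M);
     rem_loop u om h (Suc lam) R' Ls Ms R'' \<rbrakk>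
   \<Longrightarrow> rem_loop u om h lam R
        ((if i = {#} then {} else {\<lparr>lev = lam, slot = u, stage = h, fpoly = L, ccoef = c\<rparr>}) \<union> Ls)
        ((if j = {#} then {} else {\<lparr>lev = lam, slot = om, stage = h, fpoly = M, ccoef = c\<rparr>}) \<union> Ms)
        R''"

definition remainder ::
  "nat \<Rightarrow> nat \<Rightarrow> nat \<Rightarrow> fcoeff depoly \<Rightarrow> factor set \<Rightarrow> factor set \<Rightarrow> fcoeff depoly \<Rightarrow> bool" where
  "remainder u om h A Ls Ms R \<longleftrightarrow> (\<exists>Ls' Ms'.
     rem_loop u om h 1 (A - linear_part A) Ls' Ms' R \<and>
     Ls = (if linear_part A \<noteq> 0 \<and> u \<ge> 1
           then {\<lparr>lev = 0, slot = u, stage = h, fpoly = delta_lin_part A, ccoef = 1\<rparr>} else {}) \<union> Ls' \<and>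
     Ms = (if linear_part A \<noteq> 0 \<and> om \<ge> 1
           then {\<lparr>lev = 0, slot = om, stage = h, fpoly = eps_lin_part A, ccoef = 1\<rparr>} else {}) \<union> Ms')"

text \<open>Extraction of the maximal power of the variable \<open>x\<close> (\<open>\<delta>\<^sub>0\<close> or \<open>\<epsilon>\<^sub>0\<close>) such that no constant
  term is left.\<close>

definition strip_var :: "fcoeff depoly \<Rightarrow> fcoeff depoly \<Rightarrow> fcoeff depoly \<Rightarrow> bool" where
  "strip_var x R R' \<longleftrightarrow> (if R = 0 then R' = 0 else
     (\<exists>\<theta>. R = x ^ \<theta> * R' \<and> no_constant R' \<and>
        (\<forall>\<theta>' R''. R = x ^ \<theta>' * R'' \<and> no_constant R'' \<longrightarrow> \<theta>' \<le> \<theta>)))"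

text \<open>The pair \<open>(\<kappa>, \<sigma>)\<close> is maximal for the componentwise order.\<close>

definition strip_both :: "fcoeff depoly \<Rightarrow> fcoeff depoly \<Rightarrow> bool" where
  "strip_both R R' \<longleftrightarrow> (if R = 0 then R' = 0 else
     (\<exists>\<kappa> \<sigma>. R = delta 0 ^ \<kappa> * eps 0 ^ \<sigma> * R' \<and> no_constant R' \<and>
        (\<forall>\<kappa>' \<sigma>' R''. R = delta 0 ^ \<kappa>' * eps 0 ^ \<sigma>' * R'' \<and> no_constant R'' \<and> \<kappa> \<le> \<kappa>' \<and> \<sigma> \<le> \<sigma>'
            \<longrightarrow> \<kappa>' = \<kappa> \<and> \<sigma>' = \<sigma>)))"

inductive delta_loop ::
  "nat \<Rightarrow> nat \<Rightarrow> fcoeff depoly \<Rightarrow> factor set \<Rightarrow> factor set \<Rightarrow> fcoeff depoly \<Rightarrow> bool"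
  for h :: nat where
  delta_stop:
  "\<lbrakk> remainder u 0 h A Ls Ms R; strip_var (delta 0) R R'; undelayed R' \<rbrakk>
   \<Longrightarrow> delta_loop h u A Ls Ms R'"
| delta_repeat:
  "\<lbrakk> remainder u 0 h A Ls Ms R; strip_var (delta 0) R R'; \<not> undelayed R';
     delta_loop h (Suc u) R' Ls' Ms' Rfin \<rbrakk>
   \<Longrightarrow> delta_loop h u A (Ls \<union> Ls') (Ms \<union> Ms') Rfin"

inductive eps_loop ::
  "nat \<Rightarrow> nat \<Rightarrow> fcoeff depoly \<Rightarrow> factor set \<Rightarrow> factor set \<Rightarrow> fcoeff depoly \<Rightarrow> bool"
  for h :: nat where
  eps_stop:
  "\<lbrakk> remainder 0 om h A Ls Ms R; strip_var (eps 0) R R'; undelayed R' \<rbrakk>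
   \<Longrightarrow> eps_loop h om A Ls Ms R'"
| eps_repeat:
  "\<lbrakk> remainder 0 om h A Ls Ms R; strip_var (eps 0) R R'; \<not> undelayed R';
     eps_loop h (Suc om) R' Ls' Ms' Rfin \<rbrakk>
   \<Longrightarrow> eps_loop h om A (Ls \<union> Ls') (Ms \<union> Ms') Rfin"

text \<open>The result of a run: \<open>\<L>\<close>, \<open>\<M>\<close>, the lists \<open>(R\<^bsub>\<delta>,h\<^esub>)\<close> and \<open>(R\<^bsub>\<epsilon>,h\<^esub>)\<close> for
  \<open>h = 0, \<dots>, h\<^sup>*\<close>, and \<open>R\<^bsub>\<delta>\<epsilon>\<^esub>\<close>. The coefficients collected in \<open>\<C>\<close> are kept with the entries; the
  operators collected in \<open>\<O>\<close> are not used by the later algorithms.\<close>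

record flf_result =
  LL :: "factor set"
  MM :: "factor set"
  R_delta :: "fcoeff depoly list"
  R_eps :: "fcoeff depoly list"
  R_mixed :: "fcoeff depoly"

inductive flf_from :: "nat \<Rightarrow> fcoeff depoly \<Rightarrow> flf_result \<Rightarrow> bool" where
  flf_stop:
  "\<lbrakk> delta_loop h 1 (delta_part A) L1 M1 RD; eps_loop h 1 (eps_part A) L2 M2 RE;
     undelayed (mixed_part A) \<rbrakk>
   \<Longrightarrow> flf_from h A \<lparr>LL = L1 \<union> L2, MM = M1 \<union> M2, R_delta = [RD], R_eps = [RE],
                     R_mixed = mixed_part A\<rparr>"
| flf_continue:
  "\<lbrakk> delta_loop h 1 (delta_part A) L1 M1 RD; eps_loop h 1 (eps_part A) L2 M2 RE;
     \<not> undelayed (mixed_part A);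
     remainder 0 0 h (mixed_part A) L3 M3 R; strip_both R R';
     flf_from (Suc h) R' X \<rbrakk>
   \<Longrightarrow> flf_from h A \<lparr>LL = L1 \<union> L2 \<union> L3 \<union> LL X, MM = M1 \<union> M2 \<union> M3 \<union> MM X,
                     R_delta = RD # R_delta X, R_eps = RE # R_eps X, R_mixed = R_mixed X\<rparr>"

definition flf :: "real depoly \<Rightarrow> flf_result \<Rightarrow> bool" where
  "flf F X \<longleftrightarrow> flf_from 0 (formal F) X"

section \<open>The MM-Algorithm\<close>

text \<open>\<open>no_lin\<close> removes the entry with index \<open>(0, 1, 0)\<close>, which is \<open>F\<^bsub>\<delta>,l\<^esub>\<close> in \<open>\<L>\<close> and
  \<open>F\<^bsub>\<epsilon>,l\<^esub>\<close> in \<open>\<M>\<close>. Another entry that merely has the same polynomial stays.\<close>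

definition no_lin :: "factor set \<Rightarrow> factor set" where
  "no_lin X = {J \<in> X. \<not> (lev J = 0 \<and> slot J = 1 \<and> stage J = 0)}"

definition bar :: "factor set \<Rightarrow> factor set" where
  "bar X = {J \<in> X. slot J \<noteq> 0}"

definition L_delta :: "flf_result \<Rightarrow> factor set" where
  "L_delta X = {J \<in> LL X. slot J \<ge> 1 \<and> stage J = 0}"

text \<open>\<^term>\<open>Gcd\<close> is normalized, so it is \<open>1\<close> iff it is \<open>\<delta>\<^sub>0\<close> up to a nonzero scalar.\<close>

definition GCDV :: "factor set \<Rightarrow> rule set" where
  "GCDV \<F> = {q. \<exists>\<A>. \<A> \<noteq> {} \<and> \<A> \<subseteq> \<F> \<and>
     (\<forall>J\<in>\<A>. eval_coeff q (ccoef J) \<noteq> 0) \<and> (\<forall>J\<in>\<F> - \<A>. eval_coeff q (ccoef J) = 0) \<and>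
     Gcd ((\<lambda>J. eval_linear q (fpoly J)) ` \<A>) \<noteq> 1}"

definition common_factor :: "real poly \<Rightarrow> factor set \<Rightarrow> rule \<Rightarrow> bool" where
  "common_factor \<Phi> \<F> q \<longleftrightarrow>
     (\<forall>J\<in>\<F>. eval_coeff q (ccoef J) \<noteq> 0 \<longrightarrow> \<Phi> dvd eval_linear q (fpoly J))"

definition LV :: "flf_result \<Rightarrow> rule set" where
  "LV X = GCDV (L_delta X)"

definition GV :: "flf_result \<Rightarrow> rule set" where
  "GV X = GCDV (LL X \<union> bar (MM X)) \<union> GCDV (bar (LL X) \<union> MM X)"

definition MV :: "flf_result \<Rightarrow> rule set" where
  "MV X = GCDV (no_lin (LL X) \<union> no_lin (bar (MM X))) \<union> GCDV (no_lin (bar (LL X)) \<union> no_lin (MM X))"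

definition DR :: "flf_result \<Rightarrow> rule set" where
  "DR X = {q. eval_depoly q (hd (R_delta X)) = 0}"

definition RV :: "flf_result \<Rightarrow> rule set" where
  "RV X = {q. (\<forall>R\<in>set (R_delta X) \<union> set (R_eps X) \<union> {R_mixed X}. eval_depoly q R = 0)}"

definition F1_of :: "flf_result \<Rightarrow> real poly set" where
  "F1_of X = {\<Phi>. \<exists>q\<in>LV X \<inter> DR X. common_factor \<Phi> (L_delta X) q}"

definition F2_of :: "flf_result \<Rightarrow> real poly set" where
  "F2_of X = {\<Phi>. \<exists>q\<in>RV X \<inter> GV X.
     common_factor \<Phi> (LL X \<union> bar (MM X)) q \<or> common_factor \<Phi> (bar (LL X) \<union> MM X) q}"

definition F3_of :: "flf_result \<Rightarrow> real poly set" where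
  "F3_of X = {\<Phi>. \<exists>q\<in>RV X \<inter> MV X.
     common_factor \<Phi> (no_lin (LL X) \<union> no_lin (bar (MM X))) q \<or>
     common_factor \<Phi> (no_lin (bar (LL X)) \<union> no_lin (MM X)) q}"

definition mm_outputs ::
  "real depoly \<Rightarrow> real poly set \<Rightarrow> real poly set \<Rightarrow> real poly set \<Rightarrow> bool" where
  "mm_outputs F F1 F2 F3 \<longleftrightarrow> (\<exists>X. flf F X \<and> F1 = F1_of X \<and> F2 = F2_of X \<and> F3 = F3_of X)"

section \<open>Systems, initial conditions and feedback\<close>

type_synonym signal = "int \<Rightarrow> real"

definition causal :: "signal \<Rightarrow> bool" where
  "causal y \<longleftrightarrow> (\<forall>t<0. y t = 0)"

definition act :: "real depoly \<Rightarrow> signal \<Rightarrow> signal \<Rightarrow> signal" where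
  "act F y u t = (\<Sum>m\<in>Poly_Mapping.keys F. Poly_Mapping.lookup F m *
     (\<Prod>p\<in>#fst m. y (t - int p)) * (\<Prod>p\<in>#snd m. u (t - int p)))"

definition lin_act :: "real poly \<Rightarrow> signal \<Rightarrow> signal" where
  "lin_act K y t = (\<Sum>k\<le>degree K. coeff K k * y (t - int k))"

text \<open>The \<open>\<delta>\<close>-polynomial \<open>F[y(t), S y(t)]\<close>, obtained by replacing each \<open>\<epsilon>\<^sub>p\<close> by
  \<open>\<delta>\<^sub>p * S\<close> and collecting terms. It determines the maximal output delay of the closed-loop system,
  i.e. the number of its initial conditions.\<close>

definition closed_loop :: "real depoly \<Rightarrow> real poly \<Rightarrow> real depoly" where
  "closed_loop F S = (\<Sum>m\<in>Poly_Mapping.keys F. scale (Poly_Mapping.lookup F m)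
     ((\<Prod>p\<in>#fst m. delta p) * (\<Prod>p\<in>#snd m. delta_linear (monom 1 p * S))))"

definition max_output_delay :: "real depoly \<Rightarrow> nat" where
  "max_output_delay G = Max (insert 0 (\<Union>m\<in>Poly_Mapping.keys G. set_mset (fst m)))"

definition closed_loop_order :: "real depoly \<Rightarrow> real poly \<Rightarrow> nat" where
  "closed_loop_order F S = max_output_delay (closed_loop F S)"

definition closed_loop_output :: "real depoly \<Rightarrow> real poly \<Rightarrow> real list \<Rightarrow> signal \<Rightarrow> bool" where
  "closed_loop_output F S y0 y \<longleftrightarrow> causal y \<and> length y0 = closed_loop_order F S \<and>
     (\<forall>i<length y0. y (int i) = y0 ! i) \<and>
     (\<forall>t\<ge>int (closed_loop_order F S). act F y (lin_act S y) t = 0)"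

definition linear_output :: "real poly \<Rightarrow> real list \<Rightarrow> signal \<Rightarrow> bool" where
  "linear_output K psi0 psi \<longleftrightarrow> causal psi \<and> length psi0 = degree K \<and>
     (\<forall>i<length psi0. psi (int i) = psi0 ! i) \<and>
     (\<forall>t\<ge>int (degree K). lin_act K psi t = 0)"

text \<open>The closed-loop equation, at the past values of \<open>y\<close>, has no solution for \<open>y(t)\<close> other than the
  value of \<open>y\<close> itself.\<close>

definition determines_output :: "real depoly \<Rightarrow> real poly \<Rightarrow> signal \<Rightarrow> bool" where
  "determines_output F S y \<longleftrightarrow> (\<forall>t\<ge>int (closed_loop_order F S). \<forall>v.
     act F (y(t := v)) (lin_act S (y(t := v))) t = 0 \<longrightarrow> v = y t)"

text \<open>The signal \<open>y\<close> is an output of the closed loop, and it is the only one provided that the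
  closed-loop equation can be solved uniquely for \<open>y(t)\<close>. (An arbitrary linear feedback can cancel
  the occurrence of \<open>y(t)\<close>, so the proviso is not automatic.)\<close>

definition closed_loop_produces :: "real depoly \<Rightarrow> real poly \<Rightarrow> real list \<Rightarrow> signal \<Rightarrow> bool" where
  "closed_loop_produces F S y0 y \<longleftrightarrow> closed_loop_output F S y0 y \<and>
     (determines_output F S y \<longrightarrow> (\<forall>y'. closed_loop_output F S y0 y' \<longrightarrow> y' = y))"

text \<open>\<open>y0\<close> are the initial conditions of the system with the larger maximal output delay, \<open>psi0\<close>
  those of the system with output \<open>psi\<close>; equal delays are allowed.\<close>

definition identical_ic :: "real list \<Rightarrow> real list \<Rightarrow> signal \<Rightarrow> bool" where
  "identical_ic y0 psi0 psi \<longleftrightarrow> length psi0 \<le> length y0 \<and>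
     (\<forall>i<length psi0. psi0 ! i = y0 ! i) \<and>
     (\<forall>i. length psi0 \<le> i \<and> i < length y0 \<longrightarrow> y0 ! i = psi (int i))"

definition ic_relation :: "real poly \<Rightarrow> real list \<Rightarrow> bool" where
  "ic_relation K v \<longleftrightarrow> (\<Sum>i<length v. coeff K i * v ! (length v - 1 - i)) = 0"

text \<open>The relation \<open>\<Phi>~ y\<^sub>0 = 0\<close> for initial conditions of a solution of \<open>A\<^sub>d y = 0\<close>. Given \<open>A\<^sub>d y = 0\<close>,
  the sequence \<open>\<Phi>~ y\<close> satisfies a linear recurrence of order \<open>n = degree A\<^sub>d - degree \<Phi>~\<close>, so
  that it vanishes only if it does so at \<open>n\<close> consecutive instants: the relation is required for
  \<open>(y\<^sub>0, \<dots>, y\<^bsub>k-1\<^esub>)\<close> and the \<open>n - 1\<close> next shorter initial segments. For \<open>n = 1\<close> this is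
  \<open>ic_relation \<Phi>~ y\<^sub>0\<close>.\<close>

definition ic_relations :: "real poly \<Rightarrow> real poly \<Rightarrow> real list \<Rightarrow> bool" where
  "ic_relations Ad \<Phi>t y0 \<longleftrightarrow>
     (\<forall>i < degree Ad - degree \<Phi>t. ic_relation \<Phi>t (take (length y0 - i) y0))"

definition feedback_law ::
  "real poly \<Rightarrow> real poly \<Rightarrow> real poly set \<Rightarrow> real poly set \<Rightarrow> real poly set \<Rightarrow>
   real poly \<Rightarrow> real poly \<Rightarrow> real poly \<Rightarrow> bool" where
  "feedback_law A B F1 F2 F3 \<Phi> D S \<longleftrightarrow> (\<exists>Q.
     (\<Phi> \<in> F1 \<and> S = Q * D) \<or>
     (\<Phi> \<in> F2 \<and> S = Q) \<or>
     (\<Phi> \<in> F3 \<and> (\<exists>R0 Z0. R0 * D + Z0 * B = A \<and> S = Z0 + Q * D)))"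

end

theory Submission
  imports Defs
begin

text \<open>
  Let \<open>D\<close> be \<open>A\<^sub>d\<close> or \<open>\<Phi>~\<close>. As the leading coefficient of \<open>A\<^sub>d\<close> is nonzero, the desired output extends
  backwards to a signal \<open>z\<close> on all of \<open>\<int>\<close> with \<open>A\<^sub>d z = 0\<close>, and then \<open>D z = 0\<close> everywhere: for
  \<open>D = \<Phi>~\<close>, the signal \<open>D z\<close> satisfies a linear recurrence and vanishes on a full window of instants.
  Evaluation of formal polynomials at a rule and at \<open>z\<close> is a ring homomorphism, and at the chosen
  rule each term split off by the FLF-Algorithm has a factor divisible by \<open>D\<close>, so
  \<open>F[z, S z] = 0\<close> on \<open>\<int>\<close>. Once the order of the closed loop is reached, its equation only refers to
  nonnegative times, where \<open>z\<close> is the desired output. Cancellations in the closed loop can make this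
  order smaller than the delays of the individual terms; hence the detour through \<open>\<int>\<close>.
\<close>

section \<open>Evaluation of polynomial mappings\<close>

text \<open>A ring homomorphism on coefficients and a monoid homomorphism on monomials give a ring
  homomorphism. This covers formal coefficients at a rule as well as real and formal
  \<delta>\<epsilon>-polynomials at signals.\<close>

locale poly_mapping_eval =
  fixes h :: "'c::comm_ring_1 \<Rightarrow> 'd::comm_ring_1"
    and g :: "'m::cancel_comm_monoid_add \<Rightarrow> 'd"
  assumes h_add: "h (a + b) = h a + h b"
    and h_mult: "h (a * b) = h a * h b"
    and h_one: "h 1 = 1"
    and g_zero: "g 0 = 1"
    and g_add: "g (m + n) = g m * g n"
begin

definition ev :: "('m \<Rightarrow>\<^sub>0 'c) \<Rightarrow> 'd" where
  "ev F = (\<Sum>m\<in>Poly_Mapping.keys F. h (Poly_Mapping.lookup F m) * g m)"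

lemma h_zero: "h 0 = 0"
  using h_add[of 0 0] by simp

lemma ev_superset:
  assumes "finite K" "Poly_Mapping.keys F \<subseteq> K"
  shows "ev F = (\<Sum>m\<in>K. h (Poly_Mapping.lookup F m) * g m)"
  unfolding ev_def using assms by (intro sum.mono_neutral_left) (auto simp: in_keys_iff h_zero)

lemma ev_zero [simp]: "ev 0 = 0"
  by (simp add: ev_def)

lemma ev_add: "ev (F + G) = ev F + ev G"
proof -
  let ?K = "Poly_Mapping.keys F \<union> Poly_Mapping.keys G"
  have "ev (F + G) = (\<Sum>m\<in>?K. h (Poly_Mapping.lookup (F + G) m) * g m)"
    by (rule ev_superset) (auto simp: Poly_Mapping.keys_add)
  also have "\<dots> = (\<Sum>m\<in>?K. h (Poly_Mapping.lookup F m) * g m)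
                   + (\<Sum>m\<in>?K. h (Poly_Mapping.lookup G m) * g m)"
    by (simp add: lookup_add h_add distrib_right sum.distrib)
  also have "\<dots> = ev F + ev G"
    by (simp add: ev_superset[of ?K])
  finally show ?thesis .
qed

lemma ev_diff: "ev (F - G) = ev F - ev G"
  using ev_add[of "F - G" G] by simp

lemma ev_sum: "ev (sum f X) = (\<Sum>x\<in>X. ev (f x))"
  by (induction X rule: infinite_finite_induct) (simp_all add: ev_add)

lemma ev_single [simp]: "ev (Poly_Mapping.single m c) = h c * g m"
  by (cases "c = 0") (simp_all add: ev_def h_zero)

text \<open>Both factors are expanded into single monomials, where \<open>h_mult\<close> and
  \<open>g_add\<close> apply termwise.\<close>

lemma ev_mult: "ev (F * G) = ev F * ev G"
proof -
  have expand: "P = (\<Sum>m\<in>Poly_Mapping.keys P. Poly_Mapping.single m (Poly_Mapping.lookup P m))"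
    for P :: "'m \<Rightarrow>\<^sub>0 'c"
    by (rule poly_mapping_eqI)
      (auto simp: lookup_sum lookup_single in_keys_iff when_def sum.delta)
  have "F * G = (\<Sum>m\<in>Poly_Mapping.keys F. \<Sum>n\<in>Poly_Mapping.keys G.
      Poly_Mapping.single (m + n) (Poly_Mapping.lookup F m * Poly_Mapping.lookup G n))"
    by (subst (1) expand[of F], subst (1) expand[of G])
      (simp add: sum_product mult_single)
  then have "ev (F * G) = (\<Sum>m\<in>Poly_Mapping.keys F. \<Sum>n\<in>Poly_Mapping.keys G.
      (h (Poly_Mapping.lookup F m) * g m) * (h (Poly_Mapping.lookup G n) * g n))"
    by (simp add: ev_sum h_mult g_add mult_ac)
  then show ?thesis
    by (simp add: ev_def sum_product)
qed

lemma ev_one [simp]: "ev 1 = 1"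
  using ev_single[of 0 1] by (simp add: h_one g_zero del: ev_single)

lemma ev_prod_mset: "ev (\<Prod>x\<in>#X. f x) = (\<Prod>x\<in>#X. ev (f x))"
  by (induction X) (simp_all add: ev_mult)

end

interpretation eval_coeff: poly_mapping_eval "\<lambda>c. c" "\<lambda>m. \<Prod>v\<in>#m. q v"
  rewrites "poly_mapping_eval.ev (\<lambda>c. c) (\<lambda>m. \<Prod>v\<in>#m. q v) = eval_coeff q"
  for q :: rule
proof -
  show *: "poly_mapping_eval (\<lambda>c. c) (\<lambda>m. \<Prod>v\<in>#m. q v)"
    by unfold_locales simp_all
  show "poly_mapping_eval.ev (\<lambda>c. c) (\<lambda>m. \<Prod>v\<in>#m. q v) = eval_coeff q"
    by (simp add: fun_eq_iff poly_mapping_eval.ev_def[OF *] eval_coeff_def)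
qed

lemma eval_coeff_const [simp]: "eval_coeff q (const_coeff c) = c"
  by (simp add: const_coeff_def)

section \<open>Linear recurrences\<close>

lemma lin_act_superset:
  "degree K \<le> n \<Longrightarrow> lin_act K y t = (\<Sum>k\<le>n. coeff K k * y (t - int k))"
  unfolding lin_act_def by (intro sum.mono_neutral_left) (auto simp: coeff_eq_0)

lemma lin_act_zero [simp]: "lin_act 0 y t = 0"
  by (simp add: lin_act_def)

lemma lin_act_zero_signal [simp]: "lin_act K (\<lambda>_. 0) t = 0"
  by (simp add: lin_act_def)

lemma lin_act_add: "lin_act (K + L) y t = lin_act K y t + lin_act L y t"
proof -
  let ?n = "max (degree K) (degree L)"
  show ?thesis
    by (simp add: lin_act_superset[of _ ?n] degree_add_le distrib_right sum.distrib)
qed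

lemma lin_act_smult: "lin_act (smult c K) y t = c * lin_act K y t"
  by (simp add: lin_act_superset[of _ "degree K"] sum_distrib_left mult.assoc)

text \<open>Horner step: multiplication by x is a delay by one instant. It drives the inductions on
  polynomials.\<close>

lemma lin_act_pCons: "lin_act (pCons a K) y t = a * y t + lin_act K y (t - 1)"
proof -
  have "lin_act (pCons a K) y t = (\<Sum>k\<le>Suc (degree K). coeff (pCons a K) k * y (t - int k))"
    by (rule lin_act_superset) (simp add: degree_pCons_le)
  also have "\<dots> = a * y t + (\<Sum>k\<le>degree K. coeff K k * y (t - 1 - int k))"
    by (subst sum.atMost_Suc_shift) (simp add: algebra_simps)
  finally show ?thesis by (simp add: lin_act_def)
qed

text \<open>The star-product acts as composition of operators.\<close>

lemma lin_act_mult: "lin_act (K * L) y t = lin_act K (lin_act L y) t"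
  by (induction K arbitrary: t)
    (simp_all add: lin_act_pCons lin_act_add lin_act_smult mult_pCons_left)

lemma lin_act_monom: "lin_act (monom 1 p * K) y t = lin_act K y (t - int p)"
  by (simp add: lin_act_mult) (simp add: lin_act_def degree_monom_eq sum.delta
      if_distrib[of "\<lambda>x. x * _"] cong: if_cong)

lemma lin_act_cong: "(\<And>s. s \<le> t \<Longrightarrow> y s = z s) \<Longrightarrow> lin_act K y t = lin_act K z t"
  by (simp add: lin_act_def)

lemma lin_act_dvd:
  assumes "\<And>s. lin_act D y s = 0" "D dvd K"
  shows "lin_act K y t = 0"
proof -
  obtain P where "K = P * D" using assms(2) by (auto simp: dvd_def mult.commute)
  moreover have "lin_act D y = (\<lambda>_. 0)" using assms(1) by auto
  ultimately show ?thesis by (simp add: lin_act_mult)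
qed

text \<open>The equation \<open>K y = 0\<close> at instant \<open>t + degree K\<close> is solved for
  its oldest value, at \<open>t\<close>, which carries the leading coefficient. The other values lie
  later than \<open>t\<close>, hence termination.\<close>

function backward :: "real poly \<Rightarrow> signal \<Rightarrow> signal" where
  "backward K y t = (if t \<ge> 0 then y t else
     - (\<Sum>k<degree K. coeff K k * backward K y (t + int (degree K) - int k)) / lead_coeff K)"
  by auto
termination by (relation "measure (\<lambda>(K, y, t). nat (- t))") auto

declare backward.simps [simp del]

lemma backward_nonneg: "t \<ge> 0 \<Longrightarrow> backward K y t = y t"
  by (simp add: backward.simps)

text \<open>From \<open>degree K\<close> on, only nonnegative times are read. Earlier, the oldest
  value read is at a negative time and was defined by this very equation.\<close>

lemma lin_act_backward:
  assumes "K \<noteq> 0" "\<And>t. t \<ge> int (degree K) \<Longrightarrow> lin_act K y t = 0"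
  shows "lin_act K (backward K y) t = 0"
proof (cases "t \<ge> int (degree K)")
  case True
  then have "lin_act K (backward K y) t = lin_act K y t"
    by (auto simp: lin_act_def backward_nonneg intro!: sum.cong)
  then show ?thesis using assms(2) True by simp
next
  case False
  have "lead_coeff K * backward K y (t - int (degree K))
      = - (\<Sum>k<degree K. coeff K k * backward K y (t - int k))"
    using False assms(1) by (subst backward.simps) simp
  then show ?thesis
    by (simp add: lin_act_def lessThan_Suc_atMost[symmetric])
qed

text \<open>Zeros on a window as long as the order spread upwards by solving for the newest value
  that occurs and downwards by solving for the oldest.\<close>

lemma recurrence_vanishes:
  assumes "P \<noteq> 0" and rec: "\<And>t. lin_act P z t = 0"
    and window: "\<And>s. a \<le> s \<Longrightarrow> s < a + int (degree P) \<Longrightarrow> z s = 0"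
  shows "z s = 0"
proof -
  have other: "z (t - int r) = 0"
    if "coeff P r \<noteq> 0" "\<And>k. k \<le> degree P \<Longrightarrow> k \<noteq> r \<Longrightarrow> coeff P k \<noteq> 0 \<Longrightarrow> z (t - int k) = 0" for t r
  proof -
    have r: "r \<le> degree P" using that(1) by (rule le_degree)
    have "lin_act P z t = coeff P r * z (t - int r)
        + (\<Sum>k\<in>{..degree P} - {r}. coeff P k * z (t - int k))"
      unfolding lin_act_def using r by (subst sum.remove[of _ r]) auto
    also have "(\<Sum>k\<in>{..degree P} - {r}. coeff P k * z (t - int k)) = 0"
      using that(2) by (intro sum.neutral) auto
    finally show ?thesis using rec that(1) by simp
  qed
  have up: "z (a + int i) = 0" for i
  proof (induction i rule: less_induct)
    case (less i)
    show ?case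
    proof (cases "i < degree P")
      case False
      \<comment> \<open>The low coefficients of \<open>P\<close> may vanish, so the newest value
        that really occurs has delay \<open>r\<close>, not 0.\<close>
      define r where "r = (LEAST r. coeff P r \<noteq> 0)"
      have r: "coeff P r \<noteq> 0"
        unfolding r_def by (rule LeastI[of _ "degree P"]) (simp add: assms(1))
      have min: "r \<le> k" if "coeff P k \<noteq> 0" for k
        unfolding r_def using that by (rule Least_le)
      have "z (a + int i) = 0"
      proof (rule other[of r "a + int i + int r", simplified add_diff_cancel_right', OF r])
        fix k assume k: "k \<le> degree P" "k \<noteq> r" "coeff P k \<noteq> 0"
        then have "r < k" using min[of k] by simp
        \<comment> \<open>Here \<open>k \<le> degree P \<le> i\<close> and \<open>r < k\<close>, so
          the index is a natural number below \<open>i\<close>.\<close>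
        then have "z (a + int (i + r - k)) = 0" using less k False by (intro less) linarith
        then show "z (a + int i + int r - int k) = 0"
          using k False by (simp add: of_nat_diff algebra_simps)
      qed
      then show ?thesis .
    qed (simp add: window)
  qed
  have down: "z (a - int i) = 0" if "i > 0" for i
    using that
  proof (induction i rule: less_induct)
    case (less i)
    have "z (a - int i) = 0"
    proof (rule other[of "degree P" "a - int i + int (degree P)", simplified add_diff_cancel_right'])
      fix k assume k: "k \<le> degree P" "k \<noteq> degree P"
      show "z (a - int i + int (degree P) - int k) = 0"
      \<comment> \<open>The remaining values lie between \<open>a - i\<close> and \<open>a\<close>,
        covered by induction, or at \<open>a\<close> and later, covered by
        \<open>up\<close>.\<close>
      proof (cases "i + k > degree P")
        case True
        then have "z (a - int (i + k - degree P)) = 0" using k by (intro less(1)) linarith+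
        then show ?thesis using True by (simp add: of_nat_diff algebra_simps)
      next
        case False
        then show ?thesis using up[of "degree P - i - k"] by (simp add: of_nat_diff algebra_simps)
      qed
    qed (simp add: assms(1))
    then show ?case .
  qed
  show ?thesis
    using up[of "nat (s - a)"] down[of "nat (a - s)"] by (cases "s \<ge> a") simp_all
qed

section \<open>Evaluation at signals\<close>

text \<open>The coefficient map is left open: the identity for real polynomials,
  \<open>eval_coeff q\<close> for formal ones.\<close>

locale signal_eval =
  fixes h :: "'c::comm_ring_1 \<Rightarrow> real" and y u :: signal and t :: int
  assumes hom_add: "h (a + b) = h a + h b"
    and hom_mult: "h (a * b) = h a * h b"
    and hom_one: "h 1 = 1"
begin

sublocale poly_mapping_eval h
  "\<lambda>m. (\<Prod>p\<in>#fst m. y (t - int p)) * (\<Prod>p\<in>#snd m. u (t - int p))"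
  by unfold_locales (simp_all add: hom_add hom_mult hom_one mult_ac)

lemma ev_delta: "ev (delta k) = y (t - int k)"
  by (simp add: delta_def h_one)

lemma ev_eps: "ev (eps k) = u (t - int k)"
  by (simp add: eps_def h_one)

lemma ev_scale: "ev (scale c F) = h c * ev F"
  by (simp add: scale_def ev_mult)

text \<open>The degree may drop under \<open>h\<close>, so the sum runs up to the degree before
  evaluation.\<close>

lemma lin_act_map_poly:
  "lin_act (map_poly h L) s t = (\<Sum>k\<le>degree L. h (coeff L k) * s (t - int k))"
  by (subst lin_act_superset[of _ "degree L"])
    (auto simp: coeff_map_poly h_zero coeff_eq_0 intro!: degree_le)

lemma ev_delta_linear: "ev (delta_linear L) = lin_act (map_poly h L) y t"
  by (simp add: delta_linear_def ev_sum ev_scale ev_delta lin_act_map_poly)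

lemma ev_eps_linear: "ev (eps_linear L) = lin_act (map_poly h L) u t"
  by (simp add: eps_linear_def ev_sum ev_scale ev_eps lin_act_map_poly)

text \<open>An entry 0 of a multi-index contributes the unshifted factor \<open>L\<close> or
  \<open>M\<close> itself, and one vanishing factor annihilates the product.\<close>

lemma ev_star_eq_0:
  assumes "0 \<in># fst m \<and> lin_act (map_poly h L) y t = 0 \<or> 0 \<in># snd m \<and> lin_act (map_poly h M) u t = 0"
  shows "ev (star m L M) = 0"
proof -
  have "0 \<in># image_mset (\<lambda>p. ev (delta_linear (monom 1 p * L))) (fst m)
      \<or> 0 \<in># image_mset (\<lambda>p. ev (eps_linear (monom 1 p * M))) (snd m)"
    using assms by (force simp: ev_delta_linear ev_eps_linear one_pCons[symmetric])
  then show ?thesis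
    by (auto simp: star_def ev_mult ev_prod_mset prod_mset_zero_iff)
qed

end

interpretation act: signal_eval "\<lambda>c. c" y u t
  rewrites "poly_mapping_eval.ev (\<lambda>c. c)
      (\<lambda>m. (\<Prod>p\<in>#fst m. y (t - int p)) * (\<Prod>p\<in>#snd m. u (t - int p))) F = act F y u t"
  for y u :: signal and t :: int and F
proof -
  show *: "signal_eval (\<lambda>c. c :: real)"
    by unfold_locales simp_all
  then interpret signal_eval "\<lambda>c. c" y u t .
  show "ev F = act F y u t"
    by (simp add: ev_def act_def mult.assoc)
qed

text \<open>No \<epsilon> is left after the substitution, so the second signal \<open>v\<close> is
  arbitrary.\<close>

lemma act_closed_loop: "act (closed_loop F S) y v t = act F y (lin_act S y) t"
proof -
  have "act (closed_loop F S) y v t = (\<Sum>m\<in>Poly_Mapping.keys F. Poly_Mapping.lookup F m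
     * ((\<Prod>p\<in>#fst m. y (t - int p)) * (\<Prod>p\<in>#snd m. lin_act (monom 1 p * S) y t)))"
    unfolding closed_loop_def
    by (simp add: act.ev_sum act.ev_scale act.ev_mult act.ev_prod_mset act.ev_delta
        act.ev_delta_linear map_poly_idI)
  then show ?thesis
    by (simp add: lin_act_monom act_def mult.assoc)
qed

text \<open>Only delays that survive the collection of terms count. Applied to
  \<open>closed_loop F S\<close>, this gives locality up to the true order of the closed
  loop.\<close>

lemma act_local:
  assumes "\<And>p. p \<le> max_output_delay G \<Longrightarrow> y (t - int p) = z (t - int p)"
  shows "act G y v t = act G z v t"
proof -
  have "p \<le> max_output_delay G" if "m \<in> Poly_Mapping.keys G" "p \<in># fst m" for m p
    unfolding max_output_delay_def using that by (intro Max_ge) auto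
  then show ?thesis
    unfolding act_def using assms
    by (intro sum.cong refl arg_cong2[of _ _ _ _ "(*)"] arg_cong[of _ _ prod_mset]
        image_mset_cong) auto
qed

lemma act_cong:
  assumes "\<And>s. s \<le> t \<Longrightarrow> y s = z s" "\<And>s. s \<le> t \<Longrightarrow> u s = v s"
  shows "act F y u t = act F z v t"
  unfolding act_def using assms
  by (intro sum.cong refl arg_cong2[of _ _ _ _ "(*)"] arg_cong[of _ _ prod_mset] image_mset_cong) auto

section \<open>The closed loop on solutions of a linear system\<close>

lemma closed_loop_produces_if_annihilated:
  assumes len: "length y0 = closed_loop_order F S"
    and lin: "linear_output Ad psi0 ystar"
    and ic: "identical_ic y0 psi0 ystar"
    and agree: "\<And>t. t \<ge> 0 \<Longrightarrow> z t = ystar t"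
    and zero: "\<And>t. act F z (lin_act S z) t = 0"
  shows "closed_loop_produces F S y0 ystar"
proof -
  define N where "N = closed_loop_order F S"
  have eq: "act F ystar (lin_act S ystar) t = 0" if "t \<ge> int N" for t
  proof -
    \<comment> \<open>For \<open>t \<ge> N\<close> all delays are at most \<open>t\<close>, so only
      nonnegative times are read, where \<open>z\<close> and \<open>ystar\<close> agree.\<close>
    have "act (closed_loop F S) ystar (\<lambda>_. 0) t = act (closed_loop F S) z (\<lambda>_. 0) t"
      using that by (intro act_local agree[symmetric]) (simp add: N_def closed_loop_order_def)
    then show ?thesis by (simp add: act_closed_loop zero)
  qed
  have init: "ystar (int i) = y0 ! i" if "i < length y0" for i
    using lin ic that by (cases "i < length psi0") (auto simp: linear_output_def identical_ic_def)
  have out: "closed_loop_output F S y0 ystar"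
    using lin len eq init by (simp add: closed_loop_output_def linear_output_def N_def)
  moreover have "y' = ystar"
    if det: "determines_output F S ystar" and out': "closed_loop_output F S y0 y'" for y'
  proof -
    have neg: "y' s = ystar s" if "s < 0" for s
      using that out' lin by (simp add: closed_loop_output_def linear_output_def causal_def)
    have nonneg: "y' (int i) = ystar (int i)" for i
    proof (induction i rule: less_induct)
      case (less i)
      show ?case
      proof (cases "i < N")
        case True
        then show ?thesis using out' init len by (simp add: closed_loop_output_def N_def)
      next
        case False
        \<comment> \<open>This signal has the past of \<open>ystar\<close> and the value of
          \<open>y'\<close> at instant \<open>i\<close>. By induction it agrees with
          \<open>y'\<close> up to \<open>i\<close>, so it solves the equation there and
          \<open>determines_output\<close> applies.\<close>
        let ?w = "ystar(int i := y' (int i))"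
        have past: "?w s = y' s" if "s \<le> int i" for s
        proof (cases "s < 0 \<or> s = int i")
          case False
          then show ?thesis using less[of "nat s"] that by (simp add: nat_less_iff)
        qed (auto simp: neg)
        have "act F ?w (lin_act S ?w) (int i) = act F y' (lin_act S y') (int i)"
          by (intro act_cong past lin_act_cong) auto
        also have "\<dots> = 0"
          using out' False by (simp add: closed_loop_output_def N_def)
        finally show ?thesis
          using det False by (simp add: determines_output_def N_def)
      qed
    qed
    show ?thesis
    proof
      show "y' s = ystar s" for s
        using neg[of s] nonneg[of "nat s"] by (cases "s < 0") simp_all
    qed
  qed
  ultimately show ?thesis
    by (simp add: closed_loop_produces_def)
qed

section \<open>Runs of the FLF-Algorithm\<close>

text \<open>The invariant of the loops: a polynomial stays purely \<delta>, purely \<epsilon> or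
  mixed, so every term split off has the slots that its type prescribes. The zero polynomial has
  every type.\<close>

definition typed :: "bool \<Rightarrow> bool \<Rightarrow> 'c::comm_ring_1 depoly \<Rightarrow> bool" where
  "typed a b F \<longleftrightarrow> (\<forall>m\<in>Poly_Mapping.keys F. (fst m \<noteq> {#} \<longleftrightarrow> a) \<and> (snd m \<noteq> {#} \<longleftrightarrow> b))"

lemma size_Suc_0_msetE:
  assumes "size M = Suc 0"
  obtains k where "M = {#k#}"
  using assms size_1_singleton_mset by auto

section \<open>Restriction to monomials and the types of the parts\<close>

lemma lookup_restrict_monos:
  "Poly_Mapping.lookup (restrict_monos P F) m = (if P m then Poly_Mapping.lookup F m else 0)"
  by (auto simp: restrict_monos_def lookup_sum lookup_single when_def in_keys_iff sum.delta)

lemma keys_restrict_monos: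
  "Poly_Mapping.keys (restrict_monos P F) = {m \<in> Poly_Mapping.keys F. P m}"
  by (auto simp: in_keys_iff lookup_restrict_monos split: if_splits)

lemma typed_diff: "typed a b F \<Longrightarrow> typed a b G \<Longrightarrow> typed a b (F - G)"
  using keys_diff[of F G] unfolding typed_def by blast

lemma typed_restrict_monos: "typed a b F \<Longrightarrow> typed a b (restrict_monos P F)"
  by (simp add: typed_def keys_restrict_monos)

lemma typed_delta_part: "typed True False (delta_part F)"
  by (auto simp: typed_def delta_part_def keys_restrict_monos)

lemma typed_eps_part: "typed False True (eps_part F)"
  by (auto simp: typed_def eps_part_def keys_restrict_monos)

lemma lookup_mixed_part:
  "Poly_Mapping.lookup (mixed_part F) m =
     (if (fst m = {#}) = (snd m = {#}) then Poly_Mapping.lookup F m else 0)"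
  by (auto simp: mixed_part_def delta_part_def eps_part_def lookup_minus lookup_restrict_monos)

text \<open>Being a difference, \<open>mixed_part\<close> would retain a constant term;
  \<open>no_constant\<close> excludes it.\<close>

lemma typed_mixed_part:
  assumes "no_constant F"
  shows "typed True True (mixed_part F)"
proof -
  have "fst m \<noteq> {#} \<and> snd m \<noteq> {#}" if "Poly_Mapping.lookup (mixed_part F) m \<noteq> 0" for m
    using that assms by (cases m) (auto simp: lookup_mixed_part no_constant_def split: if_splits)
  then show ?thesis
    by (auto simp: typed_def in_keys_iff)
qed

text \<open>A mixed monomial has degree at least two. Hence REMAINDER drops nothing when called with
  both slots 0, where a linear part would not be recorded.\<close>

lemma linear_part_typed_mixed:
  assumes "typed True True F"
  shows "linear_part F = 0"
proof -
  have "\<not> (m \<in> Poly_Mapping.keys F \<and> size (fst m) + size (snd m) = 1)" for m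
    using assms by (auto simp: typed_def add_is_1)
  then have "Poly_Mapping.keys (linear_part F) = {}"
    unfolding linear_part_def keys_restrict_monos by blast
  then show ?thesis
    by (auto intro!: poly_mapping_eqI simp: in_keys_iff set_eq_iff)
qed

text \<open>\<open>sum_mset\<close> reads off the delay \<open>k\<close> from the singleton
  \<open>{#k#}\<close>.\<close>

lemma lookup_delta_linear:
  "Poly_Mapping.lookup (delta_linear L) m =
     (if size (fst m) = 1 \<and> snd m = {#} then coeff L (sum_mset (fst m)) else 0)"
proof -
  have "Poly_Mapping.lookup (delta_linear L) m
      = (\<Sum>k\<le>degree L. if ({#k#}, {#}) = m then coeff L k else 0)"
    by (simp add: delta_linear_def lookup_sum scale_def delta_def mult_single lookup_single when_def
        zero_prod_def[symmetric] zero_multiset_def[symmetric])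
  also have "\<dots> = (if size (fst m) = 1 \<and> snd m = {#} then coeff L (sum_mset (fst m)) else 0)"
  proof (cases "size (fst m) = 1 \<and> snd m = {#}")
    case True
    then obtain k where "m = ({#k#}, {#})"
      by (cases m) (auto elim: size_Suc_0_msetE)
    then show ?thesis by (auto simp: sum.delta' coeff_eq_0)
  qed (auto intro!: sum.neutral)
  finally show ?thesis .
qed

lemma lookup_eps_linear:
  "Poly_Mapping.lookup (eps_linear L) m =
     (if fst m = {#} \<and> size (snd m) = 1 then coeff L (sum_mset (snd m)) else 0)"
proof -
  have "Poly_Mapping.lookup (eps_linear L) m
      = (\<Sum>k\<le>degree L. if ({#}, {#k#}) = m then coeff L k else 0)"
    by (simp add: eps_linear_def lookup_sum scale_def eps_def mult_single lookup_single when_def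
        zero_prod_def[symmetric] zero_multiset_def[symmetric])
  also have "\<dots> = (if fst m = {#} \<and> size (snd m) = 1 then coeff L (sum_mset (snd m)) else 0)"
  proof (cases "fst m = {#} \<and> size (snd m) = 1")
    case True
    then obtain k where "m = ({#}, {#k#})"
      by (cases m) (auto elim: size_Suc_0_msetE)
    then show ?thesis by (auto simp: sum.delta' coeff_eq_0)
  qed (auto intro!: sum.neutral)
  finally show ?thesis .
qed

text \<open>Injectivity makes the index set finite; over an infinite set the sum would be 0 by
  default.\<close>

lemma coeff_sum_monom_keys:
  assumes "inj f"
  shows "coeff (\<Sum>k\<in>{k. f k \<in> Poly_Mapping.keys F}. monom (Poly_Mapping.lookup F (f k)) k) n
    = Poly_Mapping.lookup F (f n)"
proof -
  have "finite {k. f k \<in> Poly_Mapping.keys F}"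
    using finite_vimageI[OF finite_keys assms] by (simp add: vimage_def)
  then show ?thesis
    by (auto simp: coeff_sum in_keys_iff sum.delta)
qed

lemma coeff_delta_lin_part:
  "coeff (delta_lin_part F) k = Poly_Mapping.lookup F ({#k#}, {#})"
  unfolding delta_lin_part_def by (rule coeff_sum_monom_keys) (auto simp: inj_def)

lemma coeff_eps_lin_part:
  "coeff (eps_lin_part F) k = Poly_Mapping.lookup F ({#}, {#k#})"
  unfolding eps_lin_part_def by (rule coeff_sum_monom_keys) (auto simp: inj_def)

lemma linear_part_typed_delta:
  assumes "typed True False F"
  shows "linear_part F = delta_linear (delta_lin_part F)"
proof (rule poly_mapping_eqI)
  fix m :: mono
  have "snd m = {#}" if "Poly_Mapping.lookup F m \<noteq> 0"
    using assms that by (auto simp: typed_def in_keys_iff)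
  then show "Poly_Mapping.lookup (linear_part F) m
      = Poly_Mapping.lookup (delta_linear (delta_lin_part F)) m"
    by (cases m; cases "Poly_Mapping.lookup F m = 0")
      (auto simp: linear_part_def lookup_restrict_monos lookup_delta_linear coeff_delta_lin_part
        elim!: size_Suc_0_msetE)
qed

lemma linear_part_typed_eps:
  assumes "typed False True F"
  shows "linear_part F = eps_linear (eps_lin_part F)"
proof (rule poly_mapping_eqI)
  fix m :: mono
  have "fst m = {#}" if "Poly_Mapping.lookup F m \<noteq> 0"
    using assms that by (auto simp: typed_def in_keys_iff)
  then show "Poly_Mapping.lookup (linear_part F) m
      = Poly_Mapping.lookup (eps_linear (eps_lin_part F)) m"
    by (cases m; cases "Poly_Mapping.lookup F m = 0")
      (auto simp: linear_part_def lookup_restrict_monos lookup_eps_linear coeff_eps_lin_part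
        elim!: size_Suc_0_msetE)
qed

text \<open>Degrees add up along a product, and cancellation can only remove monomials. Thus
  \<open>star\<close> keeps the lengths of both multi-indices.\<close>

lemma keys_prod_mset_size:
  assumes "\<And>p m. p \<in># X \<Longrightarrow> m \<in> Poly_Mapping.keys (f p) \<Longrightarrow> size (fst m) = a \<and> size (snd m) = b"
    and "m \<in> Poly_Mapping.keys (\<Prod>p\<in>#X. f p :: 'c::comm_ring_1 depoly)"
  shows "size (fst m) = a * size X \<and> size (snd m) = b * size X"
  using assms
proof (induction X arbitrary: m)
  case empty
  then show ?case by (auto simp: zero_prod_def split: if_splits)
next
  case (add x X)
  have "m \<in> Poly_Mapping.keys (f x * (\<Prod>p\<in>#X. f p))"
    using add.prems(2) by simp
  then obtain m1 m2 where "m = m1 + m2" "m1 \<in> Poly_Mapping.keys (f x)"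
      "m2 \<in> Poly_Mapping.keys (\<Prod>p\<in>#X. f p)"
    using keys_mult by blast
  moreover have "size (fst m2) = a * size X \<and> size (snd m2) = b * size X"
    using calculation(3) add.prems(1) by (intro add.IH) auto
  ultimately show ?case using add.prems(1)[of x m1] by simp
qed

lemma keys_star_size:
  assumes "m' \<in> Poly_Mapping.keys (star m L M)"
  shows "size (fst m') = size (fst m) \<and> size (snd m') = size (snd m)"
proof -
  obtain m1 m2 where m': "m' = m1 + m2"
    and m1: "m1 \<in> Poly_Mapping.keys (\<Prod>p\<in>#fst m. delta_linear (monom 1 p * L))"
    and m2: "m2 \<in> Poly_Mapping.keys (\<Prod>p\<in>#snd m. eps_linear (monom 1 p * M))"
    using assms keys_mult unfolding star_def by blast
  have "size (fst m1) = 1 * size (fst m) \<and> size (snd m1) = 0 * size (fst m)"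
    by (rule keys_prod_mset_size[OF _ m1])
      (auto simp: in_keys_iff lookup_delta_linear split: if_splits)
  moreover have "size (fst m2) = 0 * size (snd m) \<and> size (snd m2) = 1 * size (snd m)"
    by (rule keys_prod_mset_size[OF _ m2])
      (auto simp: in_keys_iff lookup_eps_linear split: if_splits)
  ultimately show ?thesis by (simp add: m')
qed

lemma typed_scale: "typed a b F \<Longrightarrow> typed a b (scale c F)"
  using keys_mult[of "Poly_Mapping.single ({#}, {#}) c" F]
  by (fastforce simp: typed_def scale_def split: if_splits)

lemma typed_star: "typed (fst m \<noteq> {#}) (snd m \<noteq> {#}) (star m L M)"
  unfolding typed_def using keys_star_size
  by (metis size_eq_0_iff_empty)

section \<open>Extraction of powers of the undelayed variables\<close>

lemma keys_single_mult:
  fixes F :: "'c::comm_ring_1 depoly"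
  assumes "m' \<in> Poly_Mapping.keys F"
  shows "m + m' \<in> Poly_Mapping.keys (Poly_Mapping.single m 1 * F)"
proof -
  have "Poly_Mapping.lookup (Poly_Mapping.single m 1 * F) (m + m') = Poly_Mapping.lookup F m'"
    by (simp add: lookup_mult lookup_single when_mult Sum_any_when_equal')
  then show ?thesis using assms by (simp add: in_keys_iff)
qed

lemma delta_power: "delta 0 ^ n = Poly_Mapping.single (replicate_mset n 0, {#}) 1"
proof (induction n)
  case 0
  show ?case by (simp add: single_one[symmetric] zero_prod_def del: single_one)
qed (simp add: delta_def mult_single)

lemma eps_power: "eps 0 ^ n = Poly_Mapping.single ({#}, replicate_mset n 0) 1"
proof (induction n)
  case 0
  show ?case by (simp add: single_one[symmetric] zero_prod_def del: single_one)
qed (simp add: eps_def mult_single)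

lemma keys_no_constant:
  "no_constant F \<Longrightarrow> m \<in> Poly_Mapping.keys F \<Longrightarrow> fst m \<noteq> {#} \<or> snd m \<noteq> {#}"
  by (cases m) (auto simp: no_constant_def in_keys_iff)

text \<open>Multiplication by a monomial shifts the monomials of \<open>R'\<close> without
  cancellation, so an \<epsilon> in \<open>R'\<close> would show up in \<open>R\<close>. Absence of
  a constant term makes every remaining monomial contain a \<delta>.\<close>

lemma typed_strip_delta:
  assumes "strip_var (delta 0) R R'" "typed True False R"
  shows "typed True False R'"
proof (cases "R = 0")
  case False
  then obtain n where R: "R = delta 0 ^ n * R'" and nc: "no_constant R'"
    using assms(1) by (auto simp: strip_var_def)
  have "snd m = {#}" if "m \<in> Poly_Mapping.keys R'" for m
    using assms(2) keys_single_mult[OF that, of "(replicate_mset n 0, {#})"]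
    by (auto simp: R delta_power typed_def)
  then show ?thesis
    using keys_no_constant[OF nc] by (auto simp: typed_def)
qed (use assms in \<open>simp add: strip_var_def\<close>)

lemma typed_strip_eps:
  assumes "strip_var (eps 0) R R'" "typed False True R"
  shows "typed False True R'"
proof (cases "R = 0")
  case False
  then obtain n where R: "R = eps 0 ^ n * R'" and nc: "no_constant R'"
    using assms(1) by (auto simp: strip_var_def)
  have "fst m = {#}" if "m \<in> Poly_Mapping.keys R'" for m
    using assms(2) keys_single_mult[OF that, of "({#}, replicate_mset n 0)"]
    by (auto simp: R eps_power typed_def)
  then show ?thesis
    using keys_no_constant[OF nc] by (auto simp: typed_def)
qed (use assms in \<open>simp add: strip_var_def\<close>)

section \<open>Slots and stages of the collected entries\<close>

lemma rem_loop_index: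
  "rem_loop v om h lam R Ls Ms R' \<Longrightarrow>
     (\<forall>J\<in>Ls. slot J = v \<and> stage J = h) \<and> (\<forall>J\<in>Ms. slot J = om \<and> stage J = h)"
  by (induction rule: rem_loop.induct) auto

lemma remainder_index:
  "remainder v om h A Ls Ms R \<Longrightarrow>
     (\<forall>J\<in>Ls. slot J = v \<and> stage J = h) \<and> (\<forall>J\<in>Ms. slot J = om \<and> stage J = h)"
  unfolding remainder_def by (elim exE conjE, drule rem_loop_index) auto

lemma delta_loop_index:
  "delta_loop h v A Ls Ms R \<Longrightarrow> (\<forall>J\<in>Ls. slot J \<ge> v \<and> stage J = h)"
  by (induction rule: delta_loop.induct) (auto dest: remainder_index Suc_leD)

lemma eps_loop_index:
  "eps_loop h om A Ls Ms R \<Longrightarrow> (\<forall>J\<in>Ms. slot J \<ge> om \<and> stage J = h)"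
  by (induction rule: eps_loop.induct) (auto dest: remainder_index Suc_leD)

lemma const_coeff_zero [simp]: "const_coeff 0 = 0"
  by (simp add: const_coeff_def)

lemma lookup_formal:
  "Poly_Mapping.lookup (formal F) m = const_coeff (Poly_Mapping.lookup F m)"
  by (simp add: formal_def map.rep_eq when_def)

section \<open>Evaluation of a run at a rule and at signals\<close>

locale flf_eval =
  fixes q :: rule and y u :: signal and t :: int and spare :: bool
begin

sublocale signal_eval "eval_coeff q" y u t
  by unfold_locales (simp_all add: eval_coeff.ev_add eval_coeff.ev_mult eval_coeff.ev_one)

text \<open>With \<open>spare\<close> set, the entries \<open>F\<^bsub>\<delta>,l\<^esub>\<close> and \<open>F\<^bsub>\<epsilon>,l\<^esub>\<close> deleted by \<^const>\<open>no_lin\<close> are exempt: for \<open>F\<^sub>3\<close>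
  they cancel each other through the Diophantine equation.\<close>

definition killed :: "signal \<Rightarrow> factor \<Rightarrow> bool" where
  "killed s J \<longleftrightarrow> spare \<and> lev J = 0 \<and> slot J = 1 \<and> stage J = 0 \<or>
     eval_coeff q (ccoef J) = 0 \<or> lin_act (eval_linear q (fpoly J)) s t = 0"

lemma ev_eval_depoly:
  assumes "eval_depoly q R = 0"
  shows "ev R = 0"
  using assms by (simp add: eval_depoly_def map_eq_zero_iff ev_def)

text \<open>Each subtracted term evaluates to 0: its coefficient vanishes at the rule, or one of its
  factors annihilates its signal. As \<open>lam \<ge> 1\<close>, the exemption in
  \<open>killed\<close>, which concerns level 0, does not interfere.\<close>

lemma rem_loop_ev:
  assumes "rem_loop v om h lam R Ls Ms R'" "lam \<ge> 1" "typed a c R"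
    and "a \<and> (\<forall>J\<in>Ls. killed y J) \<or> c \<and> (\<forall>J\<in>Ms. killed u J)"
  shows "ev R = ev R' \<and> typed a c R'"
  using assms
proof (induction rule: rem_loop.induct)
  case (rem_step R i j cc i1 j1 L lam M R' Ls Ms R'')
  let ?m = "(image_mset (\<lambda>p. p - i1) i, image_mset (\<lambda>p. p - j1) j)"
  have "(i, j) \<in> Poly_Mapping.keys R"
    using rem_step.hyps(1) by (simp add: max_nonzero_term_def)
  then have ij: "i \<noteq> {#} \<longleftrightarrow> a" "j \<noteq> {#} \<longleftrightarrow> c"
    using rem_step.prems(2) by (auto simp: typed_def)
  have "typed a c (star ?m L M)"
    using typed_star[of ?m L M] ij by simp
  then have typed: "typed a c R'"
    unfolding rem_step.hyps(7) using rem_step.prems(2) by (intro typed_diff typed_scale)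
  \<comment> \<open>Subtracting the minimum leaves an entry 0, so the generic factor itself occurs
    in the product.\<close>
  have zero: "0 \<in># image_mset (\<lambda>p. p - Min_mset X) X" if "X \<noteq> {#}" for X :: "nat multiset"
    using Min_in[of "set_mset X"] that by force
  have "eval_coeff q cc = 0 \<or> 0 \<in># fst ?m \<and> lin_act (eval_linear q L) y t = 0
      \<or> 0 \<in># snd ?m \<and> lin_act (eval_linear q M) u t = 0"
    using rem_step.prems(1,3)
  proof (elim disjE conjE)
    assume "1 \<le> lam" a "\<forall>J\<in>(if i = {#} then {} else
        {\<lparr>lev = lam, slot = v, stage = h, fpoly = L, ccoef = cc\<rparr>}) \<union> Ls. killed y J"
    then show ?thesis
      using ij zero[of i] rem_step.hyps(3) by (auto simp: killed_def)
  next
    assume "1 \<le> lam" c "\<forall>J\<in>(if j = {#} then {} else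
        {\<lparr>lev = lam, slot = om, stage = h, fpoly = M, ccoef = cc\<rparr>}) \<union> Ms. killed u J"
    then show ?thesis
      using ij zero[of j] rem_step.hyps(4) by (auto simp: killed_def)
  qed
  then have "ev (scale cc (star ?m L M)) = 0"
    using ev_star_eq_0[of ?m L M] by (auto simp: ev_scale eval_linear_def)
  then have "ev R = ev R'"
    by (simp add: rem_step.hyps(7) ev_diff)
  then show ?case
    using rem_step.IH[OF _ typed] rem_step.prems by auto
qed simp

lemma remainder_ev:
  assumes "remainder v om h A Ls Ms R" "typed a c A"
    and "a \<and> (\<forall>J\<in>Ls. killed y J) \<or> c \<and> (\<forall>J\<in>Ms. killed u J)"
  shows "ev A = ev (linear_part A) + ev R \<and> typed a c R"
proof -
  obtain Ls' Ms' where loop: "rem_loop v om h 1 (A - linear_part A) Ls' Ms' R"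
    and sub: "Ls' \<subseteq> Ls" "Ms' \<subseteq> Ms"
    using assms(1) by (auto simp: remainder_def)
  have "typed a c (A - linear_part A)"
    unfolding linear_part_def using assms(2) by (intro typed_diff typed_restrict_monos)
  moreover have "a \<and> (\<forall>J\<in>Ls'. killed y J) \<or> c \<and> (\<forall>J\<in>Ms'. killed u J)"
    using assms(3) sub by blast
  ultimately have "ev (A - linear_part A) = ev R \<and> typed a c R"
    by (intro rem_loop_ev[OF loop]) simp_all
  then show ?thesis
    by (auto simp: ev_diff)
qed

lemma strip_var_ev:
  "strip_var x R R' \<Longrightarrow> ev R' = 0 \<Longrightarrow> ev R = 0"
  by (auto simp: strip_var_def ev_mult split: if_splits)

lemma strip_both_ev:
  "strip_both R R' \<Longrightarrow> ev R' = 0 \<Longrightarrow> ev R = 0"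
  by (auto simp: strip_both_def ev_mult split: if_splits)

text \<open>The linear part is recorded at level 0 with companion coefficient 1, which vanishes at
  no rule. Unless exempt, the recorded polynomial therefore annihilates \<open>y\<close>.\<close>

lemma linear_delta_ev:
  assumes "remainder v 0 h A Ls Ms R" "typed True False A" "v \<ge> 1" "\<forall>J\<in>Ls. killed y J"
    and "\<not> (spare \<and> h = 0 \<and> v = 1)"
  shows "ev (linear_part A) = 0"
proof (cases "linear_part A = 0")
  case False
  then have "\<lparr>lev = 0, slot = v, stage = h, fpoly = delta_lin_part A, ccoef = 1\<rparr> \<in> Ls"
    using assms(1,3) by (auto simp: remainder_def)
  then have "lin_act (eval_linear q (delta_lin_part A)) y t = 0"
    using assms(4,5) by (auto simp: killed_def h_one)
  then show ?thesis
    by (simp add: linear_part_typed_delta[OF assms(2)] ev_delta_linear eval_linear_def)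
qed simp

lemma linear_eps_ev:
  assumes "remainder 0 om h A Ls Ms R" "typed False True A" "om \<ge> 1" "\<forall>J\<in>Ms. killed u J"
    and "\<not> (spare \<and> h = 0 \<and> om = 1)"
  shows "ev (linear_part A) = 0"
proof (cases "linear_part A = 0")
  case False
  then have "\<lparr>lev = 0, slot = om, stage = h, fpoly = eps_lin_part A, ccoef = 1\<rparr> \<in> Ms"
    using assms(1,3) by (auto simp: remainder_def)
  then have "lin_act (eval_linear q (eps_lin_part A)) u t = 0"
    using assms(4,5) by (auto simp: killed_def h_one)
  then show ?thesis
    by (simp add: linear_part_typed_eps[OF assms(2)] ev_eps_linear eval_linear_def)
qed simp

text \<open>Vanishing is carried back from the last remainder through all passes; only the linear
  part of the first pass at stage 0 can survive.\<close>

lemma delta_loop_ev: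
  assumes "delta_loop h v A Ls Ms R" "typed True False A" "v \<ge> 1" "\<forall>J\<in>Ls. killed y J" "ev R = 0"
  shows "ev A = (if spare \<and> h = 0 \<and> v = 1 then ev (linear_part A) else 0)"
  using assms
proof (induction rule: delta_loop.induct)
  case (delta_stop v A Ls Ms R R')
  then show ?case
    using remainder_ev[of v 0 h A Ls Ms R True False] strip_var_ev[of "delta 0" R R']
      linear_delta_ev[of v h A Ls Ms R] by auto
next
  case (delta_repeat v A Ls Ms R R' Ls' Ms' Rfin)
  have R: "ev A = ev (linear_part A) + ev R" "typed True False R"
    using remainder_ev[OF delta_repeat.hyps(1)] delta_repeat.prems by auto
  \<comment> \<open>The next pass has index \<open>Suc v \<ge> 2\<close>, so the exemption is off in
    the induction hypothesis.\<close>
  have "ev R' = 0"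
    using delta_repeat.IH typed_strip_delta[OF delta_repeat.hyps(2) R(2)] delta_repeat.prems by auto
  then show ?case
    using R(1) strip_var_ev[OF delta_repeat.hyps(2)] linear_delta_ev[OF delta_repeat.hyps(1)]
      delta_repeat.prems by auto
qed

lemma eps_loop_ev:
  assumes "eps_loop h om A Ls Ms R" "typed False True A" "om \<ge> 1" "\<forall>J\<in>Ms. killed u J" "ev R = 0"
  shows "ev A = (if spare \<and> h = 0 \<and> om = 1 then ev (linear_part A) else 0)"
  using assms
proof (induction rule: eps_loop.induct)
  case (eps_stop om A Ls Ms R R')
  then show ?case
    using remainder_ev[of 0 om h A Ls Ms R False True] strip_var_ev[of "eps 0" R R']
      linear_eps_ev[of om h A Ls Ms R] by auto
next
  case (eps_repeat om A Ls Ms R R' Ls' Ms' Rfin)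
  have R: "ev A = ev (linear_part A) + ev R" "typed False True R"
    using remainder_ev[OF eps_repeat.hyps(1)] eps_repeat.prems by auto
  have "ev R' = 0"
    using eps_repeat.IH typed_strip_eps[OF eps_repeat.hyps(2) R(2)] eps_repeat.prems by auto
  then show ?case
    using R(1) strip_var_ev[OF eps_repeat.hyps(2)] linear_eps_ev[OF eps_repeat.hyps(1)]
      eps_repeat.prems by auto
qed

definition linear_ev :: "fcoeff depoly \<Rightarrow> real" where
  "linear_ev A = ev (linear_part (delta_part A)) + ev (linear_part (eps_part A))"

lemma ev_parts: "ev A = ev (delta_part A) + ev (eps_part A) + ev (mixed_part A)"
  by (simp add: mixed_part_def ev_diff)

lemma pure_parts_ev:
  assumes "delta_loop h 1 (delta_part A) L1 M1 RD" "eps_loop h 1 (eps_part A) L2 M2 RE"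
    and "\<forall>J\<in>bar L1. killed y J" "\<forall>J\<in>bar M2. killed u J" "ev RD = 0" "ev RE = 0"
  shows "ev A = (if spare \<and> h = 0 then linear_ev A else 0) + ev (mixed_part A)"
proof -
  \<comment> \<open>Both loops start at index 1, so none of these entries has slot 0.\<close>
  have "bar L1 = L1" "bar M2 = M2"
    using delta_loop_index[OF assms(1)] eps_loop_index[OF assms(2)] by (auto simp: bar_def)
  then show ?thesis
    using delta_loop_ev[OF assms(1) typed_delta_part] eps_loop_ev[OF assms(2) typed_eps_part]
      assms(3-6) ev_parts[of A]
    by (auto simp: linear_ev_def)
qed

text \<open>Pure parts need the entries of nonzero slot on both sides. A mixed term vanishes as soon
  as its \<delta>-factor or its \<epsilon>-factor does, so one full side suffices, matching the two
  unions in \<open>GV\<close> and \<open>MV\<close>.\<close>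

lemma flf_from_ev:
  assumes "flf_from h A X" "no_constant A"
    and "\<forall>R\<in>set (R_delta X) \<union> set (R_eps X) \<union> {R_mixed X}. ev R = 0"
    and "\<forall>J\<in>bar (LL X). killed y J" "\<forall>J\<in>bar (MM X). killed u J"
    and "(\<forall>J\<in>LL X. killed y J) \<or> (\<forall>J\<in>MM X. killed u J)"
  shows "ev A = (if spare \<and> h = 0 then linear_ev A else 0)"
  using assms
proof (induction rule: flf_from.induct)
  case (flf_stop h A L1 M1 RD L2 M2 RE)
  have "ev A = (if spare \<and> h = 0 then linear_ev A else 0) + ev (mixed_part A)"
    using flf_stop by (intro pure_parts_ev[of h A L1 M1 RD L2 M2 RE]) (auto simp: bar_def)
  then show ?case
    using flf_stop.prems by simp
next
  case (flf_continue h A L1 M1 RD L2 M2 RE L3 M3 R R' X)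
  have pure: "ev A = (if spare \<and> h = 0 then linear_ev A else 0) + ev (mixed_part A)"
    using flf_continue.prems
    by (intro pure_parts_ev[OF flf_continue.hyps(1,2)]) (auto simp: bar_def)
  have mixed: "ev (mixed_part A) = ev R"
    using remainder_ev[OF flf_continue.hyps(4) typed_mixed_part] flf_continue.prems
      linear_part_typed_mixed[OF typed_mixed_part, of A]
    by auto
  \<comment> \<open>The recursion runs at stage \<open>Suc h\<close>, where nothing is
    exempt.\<close>
  have "ev R' = 0"
  proof (cases "R = 0")
    case True
    then show ?thesis using flf_continue.hyps(5) by (simp add: strip_both_def)
  next
    case False
    then have "no_constant R'"
      using flf_continue.hyps(5) by (auto simp: strip_both_def)
    then show ?thesis
      using flf_continue.IH flf_continue.prems by (auto simp: bar_def)
  qed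
  then show ?case
    using pure mixed strip_both_ev[OF flf_continue.hyps(5)] by simp
qed

lemma ev_formal: "ev (formal F) = act F y u t"
proof -
  have "Poly_Mapping.keys (formal F) \<subseteq> Poly_Mapping.keys F"
    by (auto simp: in_keys_iff lookup_formal)
  then have "ev (formal F) = (\<Sum>m\<in>Poly_Mapping.keys F. eval_coeff q (Poly_Mapping.lookup (formal F) m)
      * ((\<Prod>p\<in>#fst m. y (t - int p)) * (\<Prod>p\<in>#snd m. u (t - int p))))"
    by (intro ev_superset) auto
  then show ?thesis
    by (simp add: lookup_formal act_def mult.assoc)
qed

text \<open>The coefficients of \<open>formal F\<close> are constants, so the value does not depend
  on the rule.\<close>

lemma linear_ev_formal:
  "linear_ev (formal F) = lin_act (delta_lin_part F) y t + lin_act (eps_lin_part F) u t"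
proof -
  have "map_poly (eval_coeff q) (delta_lin_part (delta_part (formal F))) = delta_lin_part F"
    by (rule poly_eqI)
      (simp add: coeff_map_poly h_zero coeff_delta_lin_part delta_part_def lookup_restrict_monos
        lookup_formal)
  moreover have "map_poly (eval_coeff q) (eps_lin_part (eps_part (formal F))) = eps_lin_part F"
    by (rule poly_eqI)
      (simp add: coeff_map_poly h_zero coeff_eps_lin_part eps_part_def lookup_restrict_monos
        lookup_formal)
  ultimately show ?thesis
    by (simp add: linear_ev_def linear_part_typed_delta[OF typed_delta_part]
        linear_part_typed_eps[OF typed_eps_part] ev_delta_linear ev_eps_linear)
qed

lemma ev_zero_input:
  assumes "typed a True G" "\<And>s. u s = 0"
  shows "ev G = 0"
proof -
  have "(\<Prod>p\<in>#snd m. u (t - int p)) = 0" if "m \<in> Poly_Mapping.keys G" for m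
  proof -
    have "snd m \<noteq> {#}" using that assms(1) by (simp add: typed_def)
    then obtain p where "p \<in># snd m" by (meson multiset_nonemptyE)
    then show ?thesis using assms(2) by (force simp: prod_mset_zero_iff)
  qed
  then show ?thesis
    unfolding ev_def by (intro sum.neutral) auto
qed

text \<open>A multiple \<open>K\<close> of \<open>D\<close> also annihilates \<open>S v\<close>, as
  \<open>K * S\<close> is again a multiple of \<open>D\<close>. Entries not covered by
  \<open>common_factor\<close> have vanishing companion coefficient and count as killed.\<close>

lemma killed_common_factor:
  assumes "common_factor \<Phi> \<F> q" "J \<in> \<F>" "D dvd \<Phi>" "\<And>s. lin_act D v s = 0"
  shows "killed v J" "killed (lin_act S v) J"
proof -
  have "D dvd eval_linear q (fpoly J)" if "eval_coeff q (ccoef J) \<noteq> 0"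
    using assms that dvd_trans unfolding common_factor_def by blast
  then show "killed v J" "killed (lin_act S v) J"
    using assms(4) lin_act_dvd[of D v, OF assms(4)]
    by (auto simp: killed_def lin_act_mult[symmetric])
qed

end

section \<open>Vanishing of the closed loop under the three feedback laws\<close>

lemma flf_from_first_stage:
  assumes "flf_from h A X"
  obtains L1 M1 where "delta_loop h 1 (delta_part A) L1 M1 (hd (R_delta X))" "L1 \<subseteq> LL X"
  using assms by cases auto

lemma act_feedback_law_eq_0:
  assumes nc: "no_constant F" and A: "delta_lin_part F = A" and B: "eps_lin_part F = - B"
    and X: "flf F X" and D: "D dvd \<Phi>" and z: "\<And>s. lin_act D z s = 0"
    and law: "feedback_law A B (F1_of X) (F2_of X) (F3_of X) \<Phi> D S"
  shows "act F z (lin_act S z) t = 0"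
proof -
  have run: "flf_from 0 (formal F) X" using X by (simp add: flf_def)
  have nc': "no_constant (formal F)" using nc by (simp add: no_constant_def lookup_formal)
  obtain Q where "\<Phi> \<in> F1_of X \<and> S = Q * D \<or> \<Phi> \<in> F2_of X \<or>
      \<Phi> \<in> F3_of X \<and> (\<exists>R0 Z0. R0 * D + Z0 * B = A \<and> S = Z0 + Q * D)"
    using law by (auto simp: feedback_law_def)
  then show ?thesis
  proof (elim disjE conjE exE)
    assume "\<Phi> \<in> F1_of X" and S: "S = Q * D"
    then obtain q where q: "q \<in> DR X" "common_factor \<Phi> (L_delta X) q"
      by (auto simp: F1_of_def)
    interpret flf_eval q z "lin_act S z" t False .
    obtain L1 M1 where loop: "delta_loop 0 1 (delta_part (formal F)) L1 M1 (hd (R_delta X))"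
      and sub: "L1 \<subseteq> LL X"
      using flf_from_first_stage[OF run] .
    have "L1 \<subseteq> L_delta X"
      using delta_loop_index[OF loop] sub by (auto simp: L_delta_def)
    then have "\<forall>J\<in>L1. killed z J"
      using killed_common_factor(1)[OF q(2) _ D z] by blast
    moreover have "ev (hd (R_delta X)) = 0"
      using q(1) by (simp add: DR_def ev_eval_depoly)
    ultimately have "ev (delta_part (formal F)) = 0"
      using delta_loop_ev[OF loop typed_delta_part] by simp
    \<comment> \<open>\<open>S\<close> is a multiple of \<open>D\<close>, so the input vanishes
      identically and removes the \<epsilon>-part and the mixed part.\<close>
    moreover have "lin_act S z s = 0" for s
      using lin_act_dvd[OF z, of S] S by simp
    ultimately have "ev (formal F) = 0"
      using ev_parts[of "formal F"] ev_zero_input[OF typed_eps_part, of "formal F"]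
        ev_zero_input[OF typed_mixed_part[OF nc']] by simp
    then show ?thesis by (simp add: ev_formal)
  next
    assume "\<Phi> \<in> F2_of X"
    then obtain q where q: "q \<in> RV X"
      "common_factor \<Phi> (LL X \<union> bar (MM X)) q \<or> common_factor \<Phi> (bar (LL X) \<union> MM X) q"
      by (auto simp: F2_of_def)
    interpret flf_eval q z "lin_act S z" t False .
    have sub: "bar (LL X) \<subseteq> LL X" "bar (MM X) \<subseteq> MM X" by (auto simp: bar_def)
    have "(\<forall>J\<in>bar (LL X). killed z J) \<and> (\<forall>J\<in>bar (MM X). killed (lin_act S z) J) \<and>
      ((\<forall>J\<in>LL X. killed z J) \<or> (\<forall>J\<in>MM X. killed (lin_act S z) J))"
      using q(2) killed_common_factor[OF _ _ D z] sub by blast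
    then have "ev (formal F) = 0"
      using flf_from_ev[OF run nc'] q(1) by (simp add: RV_def ev_eval_depoly)
    then show ?thesis by (simp add: ev_formal)
  next
    fix R0 Z0
    assume "\<Phi> \<in> F3_of X" and R0: "R0 * D + Z0 * B = A" and S: "S = Z0 + Q * D"
    then obtain q where q: "q \<in> RV X"
      "common_factor \<Phi> (no_lin (LL X) \<union> no_lin (bar (MM X))) q \<or>
       common_factor \<Phi> (no_lin (bar (LL X)) \<union> no_lin (MM X)) q"
      by (auto simp: F3_of_def)
    interpret flf_eval q z "lin_act S z" t True .
    have sub: "bar (LL X) \<subseteq> LL X" "bar (MM X) \<subseteq> MM X" by (auto simp: bar_def)
    \<comment> \<open>What \<open>no_lin\<close> deletes is exactly what \<open>spare\<close>
      exempts, so the common factor still yields all entries killed.\<close>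
    have exempt: "killed v J" if "J \<in> Y" "J \<notin> no_lin Y" for v J Y
      using that by (auto simp: killed_def no_lin_def)
    have "no_lin (bar Y) \<subseteq> no_lin Y" for Y by (auto simp: no_lin_def bar_def)
    then have "(\<forall>J\<in>bar (LL X). killed z J) \<and> (\<forall>J\<in>bar (MM X). killed (lin_act S z) J) \<and>
      ((\<forall>J\<in>LL X. killed z J) \<or> (\<forall>J\<in>MM X. killed (lin_act S z) J))"
      using q(2) killed_common_factor[OF _ _ D z] sub exempt by blast
    then have "ev (formal F) = lin_act A z t + lin_act (- B) (lin_act S z) t"
      using flf_from_ev[OF run nc'] q(1) linear_ev_formal[of F] A B
      by (simp add: RV_def ev_eval_depoly)
    also have "\<dots> = lin_act (A + - B * S) z t"
      by (simp only: lin_act_add lin_act_mult)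
    \<comment> \<open>The Diophantine equation turns the surviving linear part
      \<open>A - B * S\<close> into a multiple of \<open>D\<close>.\<close>
    also have "A + - B * S = (R0 - B * Q) * D"
      unfolding S R0[symmetric] by (simp add: algebra_simps)
    also have "lin_act \<dots> z t = 0"
      using z by (rule lin_act_dvd) simp
    finally show ?thesis by (simp add: ev_formal)
  qed
qed

text \<open>With \<open>Ad = P * K\<close>, the signal \<open>K z\<close> satisfies the recurrence
  \<open>P\<close>, and the initial relations make it vanish on \<open>degree P\<close> consecutive
  instants. For \<open>K = Ad\<close> the window is empty.\<close>

lemma backward_annihilated:
  assumes Ad: "Ad \<noteq> 0" and lin: "linear_output Ad psi0 ystar"
    and dvd: "K dvd Ad" and ic: "identical_ic y0 psi0 ystar" and rel: "ic_relations Ad K y0"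
  shows "lin_act K (backward Ad ystar) s = 0"
proof -
  define z where "z = backward Ad ystar"
  obtain P where P: "Ad = P * K" using dvd by (auto simp: dvd_def mult.commute)
  have nz: "P \<noteq> 0" "K \<noteq> 0" using Ad P by auto
  then have deg: "degree Ad = degree P + degree K" by (simp add: P degree_mult_eq)
  have len: "degree Ad \<le> length y0"
    using lin ic by (simp add: linear_output_def identical_ic_def)
  have init: "z (int i) = y0 ! i" if "i < length y0" for i
    using lin ic that unfolding z_def
    by (cases "i < length psi0") (auto simp: backward_nonneg linear_output_def identical_ic_def)
  have "lin_act Ad z t = 0" for t
    using lin Ad unfolding z_def by (intro lin_act_backward) (simp_all add: linear_output_def)
  then have rec: "lin_act P (lin_act K z) t = 0" for t
    by (simp add: P lin_act_mult)
  have rel': "lin_act K z (int (length y0) - 1 - int i) = 0" if i: "i < degree P" for i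
  proof -
    \<comment> \<open>The relation for the initial segment of length \<open>Suc n\<close> states
      that \<open>K z\<close> vanishes at instant \<open>n\<close>. As
      \<open>n \<ge> degree K\<close>, it involves all coefficients of \<open>K\<close>.\<close>
    define n where "n = length y0 - i - 1"
    have n: "length y0 - i = Suc n" "degree K \<le> n" "n < length y0" "int (length y0) - 1 - int i = int n"
      using len deg i by (auto simp: n_def)
    have ic: "ic_relation K (take (Suc n) y0)"
      using rel i deg by (simp add: ic_relations_def n(1)[symmetric])
    have "lin_act K z (int n) = (\<Sum>k\<le>n. coeff K k * z (int n - int k))"
      using n by (intro lin_act_superset)
    also have "\<dots> = (\<Sum>k\<le>n. coeff K k * y0 ! (n - k))"
      using n by (intro sum.cong) (auto simp: init[symmetric] of_nat_diff)
    also have "\<dots> = (\<Sum>k<Suc n. coeff K k * take (Suc n) y0 ! (n - k))"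
      by (simp add: lessThan_Suc_atMost)
    also have "\<dots> = 0"
      using ic n(3) by (simp add: ic_relation_def del: nth_take)
    finally show ?thesis using n by simp
  qed
  have "lin_act K z s = 0"
  proof (rule recurrence_vanishes[OF nz(1) rec, of "int (length y0) - int (degree P)"])
    fix r assume "int (length y0) - int (degree P) \<le> r"
      "r < int (length y0) - int (degree P) + int (degree P)"
    then show "lin_act K z r = 0"
      using rel'[of "nat (int (length y0) - 1 - r)"] by simp
  qed
  then show ?thesis by (simp add: z_def)
qed

theorem theorem5p2:
  fixes F :: "real depoly" and A B Ad :: "real poly" and F1 F2 F3 :: "real poly set"
  assumes no_const: "no_constant F"
    and y_occurs: "Poly_Mapping.lookup F ({#0#}, {#}) \<noteq> 0"
    and A: "delta_lin_part F = A"
    and B: "eps_lin_part F = - B"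
    and Ad: "Ad \<noteq> 0"
    and outputs: "mm_outputs F F1 F2 F3"
    and nonempty: "F1 \<noteq> {} \<or> F2 \<noteq> {} \<or> F3 \<noteq> {}"
  shows
    "(Ad \<in> F1 \<union> F2 \<union> F3 \<longrightarrow>
       (\<forall>S. feedback_law A B F1 F2 F3 Ad Ad S \<longrightarrow>
         (\<forall>y0 psi0 ystar.
            length y0 = closed_loop_order F S \<and> linear_output Ad psi0 ystar \<and>
            identical_ic y0 psi0 ystar
            \<longrightarrow> closed_loop_produces F S y0 ystar)))
     \<and>
     (\<forall>G1 G2 G3.
        Ad \<notin> F1 \<union> F2 \<union> F3 \<and>
        G1 \<subseteq> F1 \<and> G2 \<subseteq> F2 \<and> G3 \<subseteq> F3 \<and> \<not> (G1 = {} \<and> G2 = {} \<and> G3 = {}) \<and>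
        (\<forall>\<Phi>\<in>G1 \<union> G2 \<union> G3. gcd Ad \<Phi> \<noteq> 1)
        \<longrightarrow>
       (\<forall>\<Phi>\<in>G1 \<union> G2 \<union> G3. \<forall>c \<Phi>t S. c \<noteq> 0 \<and> \<Phi>t = smult c (gcd Ad \<Phi>) \<and>
          feedback_law A B G1 G2 G3 \<Phi> \<Phi>t S \<longrightarrow>
         (\<forall>y0 psi0 ystar.
            length y0 = closed_loop_order F S \<and> linear_output Ad psi0 ystar \<and>
            identical_ic y0 psi0 ystar \<and> ic_relations Ad \<Phi>t y0
            \<longrightarrow> closed_loop_produces F S y0 ystar)))"
proof -
  obtain X where X: "flf F X" "F1 = F1_of X" "F2 = F2_of X" "F3 = F3_of X"
    using outputs by (auto simp: mm_outputs_def)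
  \<comment> \<open>Both claims are instances: \<open>K\<close> and \<open>\<Phi>\<close> are both
    \<open>Ad\<close> in (a), and \<open>K\<close> is the greatest common divisor, up to a scalar,
    in (b).\<close>
  have main: "closed_loop_produces F S y0 ystar"
    if "K dvd Ad" "K dvd \<Phi>" "feedback_law A B F1 F2 F3 \<Phi> K S"
      "length y0 = closed_loop_order F S" "linear_output Ad psi0 ystar"
      "identical_ic y0 psi0 ystar" "ic_relations Ad K y0" for K \<Phi> S y0 psi0 ystar
  proof (rule closed_loop_produces_if_annihilated[OF that(4-6)])
    show "act F (backward Ad ystar) (lin_act S (backward Ad ystar)) t = 0" for t
      by (rule act_feedback_law_eq_0[OF no_const A B X(1) that(2)
            backward_annihilated[OF Ad that(5,1,6,7)] that(3)[unfolded X(2-4)]])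
  qed (rule backward_nonneg)
  have mono: "feedback_law A B F1 F2 F3 \<Phi> K S"
    if "feedback_law A B G1 G2 G3 \<Phi> K S" "G1 \<subseteq> F1" "G2 \<subseteq> F2" "G3 \<subseteq> F3" for G1 G2 G3 \<Phi> K S
    using that unfolding feedback_law_def by blast
  have gcd: "smult c (gcd Ad \<Phi>) dvd Ad" "smult c (gcd Ad \<Phi>) dvd \<Phi>" if "c \<noteq> 0" for c \<Phi>
    using that by (simp_all add: smult_dvd_iff)
  show ?thesis
  proof (intro conjI allI impI ballI; elim conjE)
    fix S y0 psi0 ystar
    assume "feedback_law A B F1 F2 F3 Ad Ad S" "length y0 = closed_loop_order F S"
      "linear_output Ad psi0 ystar" "identical_ic y0 psi0 ystar"
    then show "closed_loop_produces F S y0 ystar"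
      \<comment> \<open>For \<open>K = Ad\<close> the difference of degrees is 0, so the initial
        relations hold vacuously.\<close>
      by (rule main[OF dvd_refl dvd_refl]) (simp add: ic_relations_def)
  next
    fix G1 G2 G3 \<Phi> c \<Phi>t S y0 psi0 ystar
    assume sub: "G1 \<subseteq> F1" "G2 \<subseteq> F2" "G3 \<subseteq> F3"
      and c: "c \<noteq> 0" "\<Phi>t = smult c (gcd Ad \<Phi>)"
      and law: "feedback_law A B G1 G2 G3 \<Phi> \<Phi>t S"
      and ic: "length y0 = closed_loop_order F S" "linear_output Ad psi0 ystar"
        "identical_ic y0 psi0 ystar" "ic_relations Ad \<Phi>t y0"
    show "closed_loop_produces F S y0 ystar"
      using main[OF _ _ mono[OF law sub] ic] gcd[OF c(1)] c(2) by simp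
  qed
qed

end
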